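(* Let $p \geq 1$ be a real number and let $E$ be a $\sigma$-Dedekind complete Banach lattice. The following are equivalent. (a) $E$ has the disjoint Dunford-Pettis* property of order $p$ (disjoint $DP^\ast P_p$). (b) Every disjoint weakly $p$-summable sequence in $E$ is almost limited. (c) For every disjoint weakly $p$-summable sequence $(x_n)_n$ in $E$ and every disjoint weak* null sequence $(x_n^\ast)_n$ in $E^\ast$, we have $x_n^\ast(x_n) \longrightarrow 0$. (d) For every disjoint weakly $p$-summable sequence $(x_n)_n$ in $E$ and every positive disjoint weak* null sequence $(x_n^\ast)_n$ in $E^\ast$, we have $x_n^\ast(x_n) \longrightarrow 0$. (e) For every disjoint weakly $p$-summable sequence $(x_n)_n$ in $E$ and every positive weak* null sequence $(x_n^\ast)_n$ in $E^\ast$, we have $x_n^\ast(x_n) \longrightarrow 0$.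
   Context: $E^\ast$ denotes the dual Banach lattice of $E$. A sequence $(x_n)_n$ in a Banach lattice is disjoint if $|x_n| \wedge |x_m| = 0$ whenever $n \neq m$, and positive if $x_n \geq 0$ for every $n$. A sequence $(x_n)_n$ in a Banach space $X$ is weakly $p$-summable if $\sum_n |x^\ast(x_n)|^p < \infty$ for every $x^\ast \in X^\ast$. A subset $A$ of a Banach space $X$ is limited if every weak* null sequence in $X^\ast$ converges uniformly to zero on $A$. A bounded subset $A$ of a Banach lattice $E$ is almost limited if every disjoint weak* null sequence in $E^\ast$ converges uniformly to zero on $A$. A sequence $(x_n)_n$ is said to have a property defined for sets if the set $\{x_n : n \in \mathbb{N}\}$ has the property. A Banach lattice $E$ has the disjoint Dunford-Pettis* property of order $p$ (disjoint $DP^\ast P_p$) if every disjoint weakly $p$-summable sequence in $E$ is limited. *)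

theory Defs
  imports "HOL-Analysis.Analysis" "HOL-Library.Lattice_Algebras"
begin

section \<open>Banach lattices\<close>

text \<open>
  Complete real normed vector lattices whose norm is a lattice norm; the modulus is
  \<^term>\<open>\<bar>x\<bar> = sup x (- x)\<close> by the axiom of \<^class>\<open>lattice_ab_group_add_abs\<close>.
\<close>

class banach_lattice = banach + ordered_real_vector + lattice_ab_group_add_abs +
  assumes norm_mono_abs: "\<bar>x\<bar> \<le> \<bar>y\<bar> \<Longrightarrow> norm x \<le> norm y"

instance real :: banach_lattice
  by standard auto

lemma norm_abs_eq [simp]: "norm \<bar>x\<bar> = norm x" for x :: "'a::banach_lattice"
  by (rule order.antisym; rule norm_mono_abs) auto

lemma norm_mono_nonneg: "norm x \<le> norm y" if "0 \<le> x" "x \<le> y" for x y :: "'a::banach_lattice"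
  using that by (intro norm_mono_abs) (auto intro: order_trans)


section \<open>The dual Banach lattice\<close>

text \<open>
  The dual space of \<^typ>\<open>'a\<close> is \<^typ>\<open>'a \<Rightarrow>\<^sub>L real\<close>, ordered by
  \<^term>\<open>f \<le> g\<close> iff \<^term>\<open>f x \<le> g x\<close> for all \<^term>\<open>x \<ge> 0\<close>. A type class arity cannot mention
  the type \<^typ>\<open>real\<close> as an argument, so the lattice instance is given for codomains that are
  totally ordered and conditionally complete, \<^typ>\<open>real\<close> being the case of interest. Suprema
  are computed by the Riesz-Kantorovich formula; the class axioms verified below show that
  they are the least upper bounds in that order.
\<close>

definition rk :: "('a::banach_lattice \<Rightarrow>\<^sub>L 'b::{banach_lattice, conditionally_complete_linorder})
    \<Rightarrow> ('a \<Rightarrow>\<^sub>L 'b) \<Rightarrow> 'a \<Rightarrow> 'b"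
  where "rk f g x = (SUP y\<in>{0..x}. blinfun_apply f y + blinfun_apply g (x - y))"

lemma ex_order_bound:
  "\<exists>u\<ge>0::'b::{banach_lattice, linorder}. \<forall>z. \<bar>z\<bar> \<le> norm z *\<^sub>R u"
proof (cases "\<exists>w::'b. w \<noteq> 0")
  case True
  then obtain w :: 'b where w: "w \<noteq> 0" by blast
  define u where "u = (2 / norm w) *\<^sub>R \<bar>w\<bar>"
  have u0: "0 \<le> u" by (simp add: u_def scaleR_nonneg_nonneg)
  have nu: "norm u = 2" using w by (simp add: u_def)
  have "\<bar>z\<bar> \<le> norm z *\<^sub>R u" for z
  proof (rule ccontr)
    assume "\<not> \<bar>z\<bar> \<le> norm z *\<^sub>R u"
    then have less: "norm z *\<^sub>R u \<le> \<bar>z\<bar>" and z: "z \<noteq> 0" by auto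
    then have "norm (norm z *\<^sub>R u) \<le> norm \<bar>z\<bar>"
      by (intro norm_mono_nonneg) (auto simp: u0 scaleR_nonneg_nonneg)
    with nu z show False by simp
  qed
  with u0 show ?thesis by blast
next
  case False
  then have "z = 0" for z :: 'b by blast
  then show ?thesis by (intro exI[of _ 0]) auto
qed

lemma norm_cSup_le:
  fixes S :: "'b::{banach_lattice, conditionally_complete_linorder} set"
  assumes ne: "S \<noteq> {}" and bdd: "bdd_above S" and nonneg: "0 \<le> Sup S"
    and le: "\<And>z. z \<in> S \<Longrightarrow> norm z \<le> c"
  shows "norm (Sup S) \<le> c"
proof (rule ccontr)
  assume *: "\<not> norm (Sup S) \<le> c"
  let ?s = "Sup S"
  have c0: "0 \<le> c" using ne le norm_ge_zero order_trans by blast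
  with * have s: "norm ?s > 0" by linarith
  then have s_pos: "?s > 0" using nonneg by (auto simp add: order.strict_iff_order)
  obtain d where d: "c < d" "d < norm ?s" using * dense[of c "norm ?s"] by auto
  define t where "t = d / norm ?s"
  have t: "0 \<le> t" "t < 1" "norm (t *\<^sub>R ?s) = d"
    using d c0 s by (auto simp: t_def)
  have "t *\<^sub>R ?s \<le> 1 *\<^sub>R ?s" using t nonneg by (intro scaleR_right_mono) auto
  moreover have "t *\<^sub>R ?s \<noteq> 1 *\<^sub>R ?s" using t s_pos by (subst scaleR_cancel_right) auto
  ultimately have "t *\<^sub>R ?s < ?s" by (simp add: order.strict_iff_order)
  then obtain z where z: "z \<in> S" "t *\<^sub>R ?s < z" using less_cSup_iff[OF ne bdd] by blast
  have "norm (t *\<^sub>R ?s) \<le> norm z"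
    using z t nonneg by (intro norm_mono_nonneg scaleR_nonneg_nonneg) auto
  with le[OF z(1)] d t(3) show False by simp
qed

context
  fixes f g :: "'a::banach_lattice \<Rightarrow>\<^sub>L 'b::{banach_lattice, conditionally_complete_linorder}"
begin

lemma rk_bound:
  assumes u: "\<And>z::'b. \<bar>z\<bar> \<le> norm z *\<^sub>R u" "0 \<le> u" and y: "0 \<le> y" "y \<le> x"
  shows "\<bar>blinfun_apply f y + blinfun_apply g (x - y)\<bar> \<le> ((norm f + norm g) * norm x) *\<^sub>R u"
proof -
  have "norm (blinfun_apply f y + blinfun_apply g (x - y))
      \<le> norm f * norm y + norm g * norm (x - y)"
    by (rule order_trans[OF norm_triangle_ineq]) (intro add_mono norm_blinfun)
  also have "\<dots> \<le> norm f * norm x + norm g * norm x"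
    using y by (intro add_mono mult_left_mono norm_mono_nonneg) auto
  finally have "norm (blinfun_apply f y + blinfun_apply g (x - y)) \<le> (norm f + norm g) * norm x"
    by (simp add: algebra_simps)
  then show ?thesis
    by (intro order_trans[OF u(1)] scaleR_right_mono u(2))
qed

lemma rk_bdd: "bdd_above ((\<lambda>y. blinfun_apply f y + blinfun_apply g (x - y)) ` {0..x})"
proof -
  obtain u :: 'b where u: "0 \<le> u" "\<And>z. \<bar>z\<bar> \<le> norm z *\<^sub>R u" using ex_order_bound by blast
  show ?thesis
    using rk_bound[OF u(2,1)] by (intro bdd_aboveI2) (auto intro: order_trans[OF abs_ge_self])
qed

lemma rk_upper: "blinfun_apply f y + blinfun_apply g (x - y) \<le> rk f g x" if "0 \<le> y" "y \<le> x"
  unfolding rk_def using that by (intro cSUP_upper rk_bdd) auto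

lemma rk_least:
  assumes "0 \<le> x" "\<And>y. 0 \<le> y \<Longrightarrow> y \<le> x \<Longrightarrow> blinfun_apply f y + blinfun_apply g (x - y) \<le> c"
  shows "rk f g x \<le> c"
  unfolding rk_def using assms by (intro cSUP_least) auto

lemma rk_add:
  assumes x: "0 \<le> x" and x': "0 \<le> x'"
  shows "rk f g (x + x') = rk f g x + rk f g x'"
proof (rule order.antisym)
  show "rk f g (x + x') \<le> rk f g x + rk f g x'"
  proof (rule rk_least)
    fix y assume y: "0 \<le> y" "y \<le> x + x'"
    define y1 where "y1 = inf y x"
    define y2 where "y2 = y - y1"
    have 1: "0 \<le> y1" "y1 \<le> x" "0 \<le> y2" using x y by (auto simp: y1_def y2_def simp del: diff_inf_eq_sup)
    have "y - x' \<le> y1" using y x' by (auto simp: y1_def algebra_simps)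
    then have 2: "y2 \<le> x'" by (simp add: y2_def algebra_simps)
    have "blinfun_apply f y + blinfun_apply g (x + x' - y)
      = (blinfun_apply f y1 + blinfun_apply g (x - y1))
        + (blinfun_apply f y2 + blinfun_apply g (x' - y2))"
      by (simp add: y2_def blinfun.bilinear_simps algebra_simps)
    also have "\<dots> \<le> rk f g x + rk f g x'" using 1 2 by (intro add_mono rk_upper)
    finally show "blinfun_apply f y + blinfun_apply g (x + x' - y) \<le> rk f g x + rk f g x'" .
  qed (use x x' in simp)
  have "rk f g x \<le> rk f g (x + x') - rk f g x'"
  proof (rule rk_least[OF x])
    fix y assume y: "0 \<le> y" "y \<le> x"
    have "rk f g x' \<le> rk f g (x + x') - (blinfun_apply f y + blinfun_apply g (x - y))"
    proof (rule rk_least[OF x'])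
      fix y' assume y': "0 \<le> y'" "y' \<le> x'"
      have "blinfun_apply f (y + y') + blinfun_apply g (x + x' - (y + y')) \<le> rk f g (x + x')"
        using y y' by (intro rk_upper) (auto intro: add_mono)
      then show "blinfun_apply f y' + blinfun_apply g (x' - y')
          \<le> rk f g (x + x') - (blinfun_apply f y + blinfun_apply g (x - y))"
        by (simp add: blinfun.bilinear_simps algebra_simps)
    qed
    then show "blinfun_apply f y + blinfun_apply g (x - y) \<le> rk f g (x + x') - rk f g x'"
      by (simp add: algebra_simps)
  qed
  then show "rk f g x + rk f g x' \<le> rk f g (x + x')" by (simp add: algebra_simps)
qed

lemma rk_scaleR_le:
  assumes x: "0 \<le> x" and c: "0 < c"
  shows "rk f g (c *\<^sub>R x) \<le> c *\<^sub>R rk f g x"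
proof (rule rk_least)
  fix y assume y: "0 \<le> y" "y \<le> c *\<^sub>R x"
  have "blinfun_apply f (y /\<^sub>R c) + blinfun_apply g (x - y /\<^sub>R c) \<le> rk f g x"
  proof (rule rk_upper)
    show "0 \<le> y /\<^sub>R c" using y c by (intro scaleR_nonneg_nonneg) auto
    have "y /\<^sub>R c \<le> (c *\<^sub>R x) /\<^sub>R c" using y c by (intro scaleR_left_mono) auto
    with c show "y /\<^sub>R c \<le> x" by simp
  qed
  then have "c *\<^sub>R (blinfun_apply f (y /\<^sub>R c) + blinfun_apply g (x - y /\<^sub>R c)) \<le> c *\<^sub>R rk f g x"
    using c by (intro scaleR_left_mono) auto
  with c show "blinfun_apply f y + blinfun_apply g (c *\<^sub>R x - y) \<le> c *\<^sub>R rk f g x"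
    by (simp add: blinfun.bilinear_simps scaleR_add_right scaleR_diff_right)
qed (use x c in \<open>auto intro: scaleR_nonneg_nonneg\<close>)

lemma rk_0 [simp]: "rk f g 0 = 0"
  using rk_add[of 0 0] by simp

lemma rk_scaleR:
  assumes x: "0 \<le> x" and c: "0 \<le> c"
  shows "rk f g (c *\<^sub>R x) = c *\<^sub>R rk f g x"
proof (cases "c = 0")
  case False
  with c have c: "0 < c" by simp
  have cx: "0 \<le> c *\<^sub>R x" using x c by (simp add: scaleR_nonneg_nonneg)
  have "rk f g x \<le> inverse c *\<^sub>R rk f g (c *\<^sub>R x)"
    using rk_scaleR_le[OF cx, of "inverse c"] c by simp
  then have "c *\<^sub>R rk f g x \<le> c *\<^sub>R (inverse c *\<^sub>R rk f g (c *\<^sub>R x))"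
    using c by (intro scaleR_left_mono) auto
  with c rk_scaleR_le[OF x c] show ?thesis by simp
qed simp

definition rk_ext :: "'a \<Rightarrow> 'b"
  where "rk_ext x = rk f g (pprt x) - rk f g (- nprt x)"

lemma rk_ext_diff:
  assumes "0 \<le> a" "0 \<le> b"
  shows "rk_ext (a - b) = rk f g a - rk f g b"
proof -
  have "pprt (a - b) + b = a + (- nprt (a - b))"
    using prts[of "a - b"] by (simp add: algebra_simps)
  then have "rk f g (pprt (a - b)) + rk f g b = rk f g a + rk f g (- nprt (a - b))"
    using assms by (metis rk_add zero_le_pprt neg_0_le_iff_le nprt_le_zero)
  then show ?thesis by (simp add: rk_ext_def algebra_simps)
qed

lemma rk_ext_nonneg: "rk_ext x = rk f g x" if "0 \<le> x"
  using rk_ext_diff[of x 0] that by simp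

lemma bounded_linear_rk_ext: "bounded_linear rk_ext"
proof -
  obtain u :: 'b where u: "0 \<le> u" "\<And>z. \<bar>z\<bar> \<le> norm z *\<^sub>R u" using ex_order_bound by blast
  have bnd: "norm (rk f g x) \<le> (norm f + norm g) * norm x * norm u" if x: "0 \<le> x" for x
  proof -
    let ?B = "((norm f + norm g) * norm x) *\<^sub>R u"
    note * = rk_bound[OF u(2,1)]
    have "- ?B \<le> blinfun_apply f x + blinfun_apply g (x - x)"
      using *[OF x order_refl] by (metis abs_le_D2 minus_le_iff)
    also have "\<dots> \<le> rk f g x" using x by (intro rk_upper) auto
    finally have "- ?B \<le> rk f g x" .
    moreover have "rk f g x \<le> ?B"
      using * by (intro rk_least x) (blast intro: order_trans abs_ge_self)
    ultimately have "\<bar>rk f g x\<bar> \<le> ?B" by (intro abs_leI) (auto simp: minus_le_iff)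
    then have "\<bar>rk f g x\<bar> \<le> \<bar>?B\<bar>" using abs_ge_self order_trans by blast
    then have "norm (rk f g x) \<le> norm ?B" by (rule norm_mono_abs)
    also have "\<dots> = (norm f + norm g) * norm x * norm u"
      by (simp only: norm_scaleR) simp
    finally show ?thesis .
  qed
  show ?thesis
  proof (rule bounded_linear_intro)
    fix x y :: 'a
    have "x + y = (pprt x + nprt x) + (pprt y + nprt y)"
      by (simp only: prts[symmetric])
    also have "\<dots> = (pprt x + pprt y) - (- nprt x + - nprt y)"
      by simp
    finally have "x + y = (pprt x + pprt y) - (- nprt x + - nprt y)" .
    then have "rk_ext (x + y) = rk f g (pprt x + pprt y) - rk f g (- nprt x + - nprt y)"
      by (simp only:) (intro rk_ext_diff add_nonneg_nonneg; simp)
    also have "\<dots> = rk_ext x + rk_ext y"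
      by (subst (1 2) rk_add) (auto simp: rk_ext_def)
    finally show "rk_ext (x + y) = rk_ext x + rk_ext y" .
  next
    fix r :: real and x :: 'a
    have x: "x = pprt x - (- nprt x)" using prts[of x] by simp
    show "rk_ext (r *\<^sub>R x) = r *\<^sub>R rk_ext x"
    proof (cases "0 \<le> r")
      case True
      have "rk_ext (r *\<^sub>R x) = rk_ext (r *\<^sub>R pprt x - r *\<^sub>R (- nprt x))"
        by (simp only: scaleR_diff_right[symmetric] x[symmetric])
      also have "\<dots> = rk f g (r *\<^sub>R pprt x) - rk f g (r *\<^sub>R (- nprt x))"
        using True by (intro rk_ext_diff scaleR_nonneg_nonneg) auto
      also have "\<dots> = r *\<^sub>R rk_ext x"
        using True by (subst (1 2) rk_scaleR) (auto simp: rk_ext_def scaleR_diff_right)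
      finally show ?thesis .
    next
      case False
      then have r: "0 \<le> - r" by simp
      have "rk_ext (r *\<^sub>R x) = rk_ext ((- r) *\<^sub>R (- nprt x) - (- r) *\<^sub>R pprt x)"
        using arg_cong[OF x, of "\<lambda>y. r *\<^sub>R y"] by (simp add: scaleR_add_right add.commute)
      also have "\<dots> = rk f g ((- r) *\<^sub>R (- nprt x)) - rk f g ((- r) *\<^sub>R pprt x)"
        using r by (intro rk_ext_diff scaleR_nonneg_nonneg) auto
      also have "\<dots> = (- r) *\<^sub>R rk f g (- nprt x) - (- r) *\<^sub>R rk f g (pprt x)"
        using r by (simp only: rk_scaleR zero_le_pprt neg_0_le_iff_le nprt_le_zero)
      also have "\<dots> = r *\<^sub>R rk_ext x"
        by (simp add: rk_ext_def scaleR_diff_right)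
      finally show ?thesis .
    qed
  next
    fix x :: 'a
    have p: "norm (pprt x) \<le> norm x" and n: "norm (- nprt x) \<le> norm x"
    proof -
      have "pprt x \<le> \<bar>x\<bar>" "- nprt x \<le> \<bar>x\<bar>" by (simp_all add: abs_prts)
      then show "norm (pprt x) \<le> norm x" "norm (- nprt x) \<le> norm x"
        using norm_mono_nonneg[of "pprt x" "\<bar>x\<bar>"] norm_mono_nonneg[of "- nprt x" "\<bar>x\<bar>"] by auto
    qed
    let ?C = "\<lambda>t. (norm f + norm g) * t * norm u"
    have "norm (rk_ext x) \<le> norm (rk f g (pprt x)) + norm (rk f g (- nprt x))"
      unfolding rk_ext_def by (rule norm_triangle_ineq4)
    also have "\<dots> \<le> ?C (norm (pprt x)) + ?C (norm (- nprt x))"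
      by (intro add_mono bnd) auto
    also have "\<dots> \<le> ?C (norm x) + ?C (norm x)"
      using p n by (intro add_mono mult_right_mono mult_left_mono) auto
    finally show "norm (rk_ext x) \<le> norm x * (2 * (norm f + norm g) * norm u)"
      by (simp add: algebra_simps)
  qed
qed

end

instantiation blinfun :: (banach_lattice, "{banach_lattice, conditionally_complete_linorder}")
  lattice_ab_group_add_abs
begin

definition less_eq_blinfun :: "('a \<Rightarrow>\<^sub>L 'b) \<Rightarrow> ('a \<Rightarrow>\<^sub>L 'b) \<Rightarrow> bool"
  where "f \<le> g \<longleftrightarrow> (\<forall>x\<ge>0. blinfun_apply f x \<le> blinfun_apply g x)"

definition less_blinfun :: "('a \<Rightarrow>\<^sub>L 'b) \<Rightarrow> ('a \<Rightarrow>\<^sub>L 'b) \<Rightarrow> bool"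
  where "f < g \<longleftrightarrow> f \<le> g \<and> \<not> g \<le> f" for f g :: "'a \<Rightarrow>\<^sub>L 'b"

definition sup_blinfun :: "('a \<Rightarrow>\<^sub>L 'b) \<Rightarrow> ('a \<Rightarrow>\<^sub>L 'b) \<Rightarrow> 'a \<Rightarrow>\<^sub>L 'b"
  where "sup f g = Blinfun (rk_ext f g)"

definition inf_blinfun :: "('a \<Rightarrow>\<^sub>L 'b) \<Rightarrow> ('a \<Rightarrow>\<^sub>L 'b) \<Rightarrow> 'a \<Rightarrow>\<^sub>L 'b"
  where "inf f g = - sup (- f) (- g)" for f g :: "'a \<Rightarrow>\<^sub>L 'b"

definition abs_blinfun :: "('a \<Rightarrow>\<^sub>L 'b) \<Rightarrow> 'a \<Rightarrow>\<^sub>L 'b"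
  where "\<bar>f\<bar> = sup f (- f)" for f :: "'a \<Rightarrow>\<^sub>L 'b"

lemma sup_blinfun_apply_nonneg: "blinfun_apply (sup f g) x = rk f g x" if "0 \<le> x"
  for f g :: "'a \<Rightarrow>\<^sub>L 'b"
  using that by (simp add: sup_blinfun_def bounded_linear_Blinfun_apply bounded_linear_rk_ext
    rk_ext_nonneg)

instance
proof
  fix f g h :: "'a \<Rightarrow>\<^sub>L 'b"
  show "(f < g) = (f \<le> g \<and> \<not> g \<le> f)" by (rule less_blinfun_def)
  show "f \<le> f" by (simp add: less_eq_blinfun_def)
  show "f \<le> h" if "f \<le> g" "g \<le> h"
    using that unfolding less_eq_blinfun_def by (blast intro: order_trans)
  show "f = g" if "f \<le> g" "g \<le> f"
  proof (rule blinfun_eqI)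
    fix x :: 'a
    have *: "blinfun_apply f y = blinfun_apply g y" if "0 \<le> y" for y
      using that \<open>f \<le> g\<close> \<open>g \<le> f\<close> by (simp add: less_eq_blinfun_def order.antisym)
    have "blinfun_apply f (pprt x - (- nprt x)) = blinfun_apply g (pprt x - (- nprt x))"
      by (simp only: blinfun.diff_right * zero_le_pprt neg_0_le_iff_le nprt_le_zero)
    then show "blinfun_apply f x = blinfun_apply g x"
      using prts[of x] by simp
  qed
  show "h + f \<le> h + g" if "f \<le> g"
    using that by (simp add: less_eq_blinfun_def blinfun.add_left)
  have sup1: "f \<le> sup f g" and sup2: "g \<le> sup f g" for f g :: "'a \<Rightarrow>\<^sub>L 'b"
    using rk_upper[of _ _ f g] rk_upper[of 0 _ f g]
    by (fastforce simp: less_eq_blinfun_def sup_blinfun_apply_nonneg)+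
  have sup3: "sup g h \<le> f" if le: "g \<le> f" "h \<le> f" for f g h :: "'a \<Rightarrow>\<^sub>L 'b"
    unfolding less_eq_blinfun_def
  proof (intro allI impI)
    fix x :: 'a assume x: "0 \<le> x"
    have "rk g h x \<le> blinfun_apply f x"
    proof (rule rk_least[OF x])
      fix y assume y: "0 \<le> y" "y \<le> x"
      have "blinfun_apply g y + blinfun_apply h (x - y)
          \<le> blinfun_apply f y + blinfun_apply f (x - y)"
        using le y by (intro add_mono) (auto simp: less_eq_blinfun_def)
      then show "blinfun_apply g y + blinfun_apply h (x - y) \<le> blinfun_apply f x"
        by (simp add: blinfun.bilinear_simps)
    qed
    with x show "blinfun_apply (sup g h) x \<le> blinfun_apply f x"
      by (simp add: sup_blinfun_apply_nonneg)
  qed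
  have neg: "- f \<le> - g \<longleftrightarrow> g \<le> f" for f g :: "'a \<Rightarrow>\<^sub>L 'b"
    by (simp add: less_eq_blinfun_def blinfun.minus_left)
  show "f \<le> sup f g" "g \<le> sup f g" by (fact sup1 sup2)+
  show "sup g h \<le> f" if "g \<le> f" "h \<le> f" using that by (rule sup3)
  show "inf f g \<le> f" "inf f g \<le> g"
    using sup1[of "- f" "- g"] sup2[of "- g" "- f"] neg[of f "inf f g"] neg[of g "inf f g"]
    by (simp_all add: inf_blinfun_def)
  show "f \<le> inf g h" if "f \<le> g" "f \<le> h"
    using sup3[of "- g" "- f" "- h"] that neg[of "inf g h" f] neg
    by (simp add: inf_blinfun_def)
  show "\<bar>f\<bar> = sup f (- f)" by (rule abs_blinfun_def)
qed

end

instance blinfun :: (banach_lattice, "{banach_lattice, conditionally_complete_linorder}")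
  banach_lattice
proof
  fix f g :: "'a \<Rightarrow>\<^sub>L 'b" and a b :: real
  show "a *\<^sub>R f \<le> a *\<^sub>R g" if "f \<le> g" "0 \<le> a"
    using that by (simp add: less_eq_blinfun_def blinfun.scaleR_left scaleR_left_mono)
  show "a *\<^sub>R f \<le> b *\<^sub>R f" if "a \<le> b" "0 \<le> f"
    using that by (simp add: less_eq_blinfun_def blinfun.scaleR_left scaleR_right_mono)
  assume le: "\<bar>f\<bar> \<le> \<bar>g\<bar>"
  show "norm f \<le> norm g"
  proof (rule norm_blinfun_bound)
    fix x :: 'a
    have abs_apply: "\<bar>blinfun_apply f x\<bar> \<le> blinfun_apply \<bar>f\<bar> \<bar>x\<bar>"
    proof -
      have 1: "\<bar>blinfun_apply f y\<bar> \<le> blinfun_apply \<bar>f\<bar> y" if "0 \<le> y" for y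
      proof -
        have "f \<le> \<bar>f\<bar>" "- f \<le> \<bar>f\<bar>" by (rule abs_ge_self abs_ge_minus_self)+
        with that have "blinfun_apply f y \<le> blinfun_apply \<bar>f\<bar> y"
            "blinfun_apply (- f) y \<le> blinfun_apply \<bar>f\<bar> y"
          unfolding less_eq_blinfun_def by blast+
        then show ?thesis by (intro abs_leI) (auto simp: blinfun.minus_left)
      qed
      have "\<bar>blinfun_apply f x\<bar> = \<bar>blinfun_apply f (pprt x) - blinfun_apply f (- nprt x)\<bar>"
        using prts[of x] by (simp flip: blinfun.diff_right)
      also have "\<dots> \<le> \<bar>blinfun_apply f (pprt x)\<bar> + \<bar>blinfun_apply f (- nprt x)\<bar>"
        by (rule abs_triangle_ineq4)
      also have "\<dots> \<le> blinfun_apply \<bar>f\<bar> (pprt x) + blinfun_apply \<bar>f\<bar> (- nprt x)"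
        by (intro add_mono 1) auto
      also have "\<dots> = blinfun_apply \<bar>f\<bar> \<bar>x\<bar>"
        by (simp add: abs_prts[of x] flip: blinfun.add_right)
      finally show ?thesis .
    qed
    also have "\<dots> \<le> blinfun_apply \<bar>g\<bar> \<bar>x\<bar>" using le by (simp add: less_eq_blinfun_def)
    finally have fg: "\<bar>blinfun_apply f x\<bar> \<le> blinfun_apply \<bar>g\<bar> \<bar>x\<bar>" .
    then have nonneg: "0 \<le> blinfun_apply \<bar>g\<bar> \<bar>x\<bar>" using abs_ge_zero order_trans by blast
    have eq: "blinfun_apply \<bar>g\<bar> \<bar>x\<bar> = rk g (- g) \<bar>x\<bar>"
      by (simp add: abs_blinfun_def sup_blinfun_apply_nonneg)
    have "norm (blinfun_apply f x) \<le> norm (blinfun_apply \<bar>g\<bar> \<bar>x\<bar>)"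
      using fg nonneg by (intro norm_mono_abs) simp
    also have "\<dots> \<le> norm g * norm x"
      unfolding eq rk_def
    proof (rule norm_cSup_le)
      fix z assume "z \<in> (\<lambda>y. blinfun_apply g y + blinfun_apply (- g) (\<bar>x\<bar> - y)) ` {0..\<bar>x\<bar>}"
      then obtain y where y: "0 \<le> y" "y \<le> \<bar>x\<bar>"
        and z: "z = blinfun_apply g y + blinfun_apply (- g) (\<bar>x\<bar> - y)" by auto
      have "z = blinfun_apply g (y - (\<bar>x\<bar> - y))"
        by (simp add: z blinfun.bilinear_simps)
      then have "norm z \<le> norm g * norm (y - (\<bar>x\<bar> - y))" by (simp only: norm_blinfun)
      also have "norm (y - (\<bar>x\<bar> - y)) \<le> norm \<bar>x\<bar>"
      proof (rule norm_mono_abs)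
        have "y - (\<bar>x\<bar> - y) \<le> \<bar>x\<bar> - 0" using y by (simp add: add_mono algebra_simps)
        moreover have "- (y - (\<bar>x\<bar> - y)) \<le> \<bar>x\<bar>" using y by (simp add: algebra_simps)
        ultimately show "\<bar>y - (\<bar>x\<bar> - y)\<bar> \<le> \<bar>\<bar>x\<bar>\<bar>" by (simp add: abs_leI)
      qed
      finally show "norm z \<le> norm g * norm x" by (simp add: mult_left_mono)
    qed (use nonneg eq rk_bdd in \<open>auto simp: rk_def\<close>)
    finally show "norm (blinfun_apply f x) \<le> norm g * norm x" .
  qed simp
qed


section \<open>Sequences and sets in Banach lattices\<close>

definition sigma_dedekind_complete :: "'a::banach_lattice itself \<Rightarrow> bool"
  where "sigma_dedekind_complete _ \<longleftrightarrow>
    (\<forall>A::'a set. countable A \<and> A \<noteq> {} \<and> bdd_above A \<longrightarrow>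
      (\<exists>s. (\<forall>a\<in>A. a \<le> s) \<and> (\<forall>b. (\<forall>a\<in>A. a \<le> b) \<longrightarrow> s \<le> b)))"

definition disjoint_seq :: "(nat \<Rightarrow> 'a::banach_lattice) \<Rightarrow> bool"
  where "disjoint_seq x \<longleftrightarrow> (\<forall>m n. n \<noteq> m \<longrightarrow> inf \<bar>x n\<bar> \<bar>x m\<bar> = 0)"

definition positive_seq :: "(nat \<Rightarrow> 'a::banach_lattice) \<Rightarrow> bool"
  where "positive_seq x \<longleftrightarrow> (\<forall>n. 0 \<le> x n)"

definition weakly_p_summable :: "real \<Rightarrow> (nat \<Rightarrow> 'a::banach) \<Rightarrow> bool"
  where "weakly_p_summable p x \<longleftrightarrow>
    (\<forall>f::'a \<Rightarrow>\<^sub>L real. summable (\<lambda>n. \<bar>blinfun_apply f (x n)\<bar> powr p))"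

definition weak_star_null :: "(nat \<Rightarrow> 'a::banach \<Rightarrow>\<^sub>L real) \<Rightarrow> bool"
  where "weak_star_null f \<longleftrightarrow> (\<forall>x. (\<lambda>n. blinfun_apply (f n) x) \<longlonglongrightarrow> 0)"

definition limited :: "'a::banach set \<Rightarrow> bool"
  where "limited A \<longleftrightarrow>
    (\<forall>f::nat \<Rightarrow> 'a \<Rightarrow>\<^sub>L real. weak_star_null f \<longrightarrow>
      uniform_limit A (\<lambda>n. blinfun_apply (f n)) (\<lambda>_. 0) sequentially)"

definition almost_limited :: "'a::banach_lattice set \<Rightarrow> bool"
  where "almost_limited A \<longleftrightarrow> bounded A \<and>
    (\<forall>f::nat \<Rightarrow> 'a \<Rightarrow>\<^sub>L real. disjoint_seq f \<and> weak_star_null f \<longrightarrow>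
      uniform_limit A (\<lambda>n. blinfun_apply (f n)) (\<lambda>_. 0) sequentially)"

definition disjoint_DP_star :: "real \<Rightarrow> 'a::banach_lattice itself \<Rightarrow> bool"
  where "disjoint_DP_star p _ \<longleftrightarrow>
    (\<forall>x::nat \<Rightarrow> 'a. disjoint_seq x \<and> weakly_p_summable p x \<longrightarrow> limited (range x))"

end

theory Submission
  imports Defs
begin

text \<open>
  The implication that carries the theorem is the one from positive disjoint weak* null sequences
  of functionals to limitedness. If \<^term>\<open>range x\<close> is not limited, some weak* null sequence stays
  away from \<^term>\<open>0\<close> along the diagonal of a subsequence of \<^term>\<open>x\<close>
  (\<open>limited_range_if_diagonals_null\<close>), so it suffices to prove \<^term>\<open>(\<lambda>n. f n (x n)) \<longlonglongrightarrow> (0::real)\<close>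
  for an arbitrary weak* null sequence \<^term>\<open>f\<close>. The functionals are made positive and disjoint
  without changing what they do on the positive parts of the \<^term>\<open>x n\<close>: replace \<^term>\<open>f n\<close> by
  the component of \<^term>\<open>\<bar>f n\<bar>\<close> in the band generated by \<^term>\<open>pprt (x n)\<close>. These components are
  disjoint because the \<^term>\<open>x n\<close> are, they agree with \<^term>\<open>\<bar>f n\<bar>\<close> at \<^term>\<open>pprt (x n)\<close>, and
  they vanish at \<^term>\<open>pprt (- x n)\<close>. Treating \<^term>\<open>\<lambda>n. - x n\<close> in the same way gives
  \<open>\<bar>f n\<bar> \<bar>x n\<bar> \<longlonglongrightarrow> 0\<close>.

  The point is that the components are again weak* null (\<open>weak_star_null_component_abs\<close>), although
  the moduli \<^term>\<open>\<bar>f n\<bar>\<close> alone may fail to be so. At a given positive element their values are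
  approximated by the values of \<^term>\<open>f n\<close> at the terms of disjoint order bounded sequences, and those
  tend to \<^term>\<open>0::real\<close> by Phillips' lemma: in a \<open>\<sigma>\<close>-Dedekind complete lattice the suprema of
  the subsequences of a disjoint order bounded positive sequence form a finitely additive
  vector measure on the subsets of \<^typ>\<open>nat\<close>.

  In the other direction limitedness gives convergence along every diagonal at once. Almost
  limited sets are required to be bounded, and for limited sets this comes from the Hahn-Banach
  theorem: along an unbounded sequence of points, scaled norming functionals are weak* null
  without being uniformly small.
\<close>

section \<open>Norming functionals and boundedness of limited sets\<close>

definition sublinear :: "('a::real_vector \<Rightarrow> real) \<Rightarrow> bool"
  where "sublinear q \<longleftrightarrow> (\<forall>x y. q (x + y) \<le> q x + q y) \<and> (\<forall>c\<ge>0. \<forall>x. q (c *\<^sub>R x) = c * q x)"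

lemma sublinear_add: "sublinear q \<Longrightarrow> q (x + y) \<le> q x + q y"
  by (simp add: sublinear_def)

lemma sublinear_scaleR: "sublinear q \<Longrightarrow> 0 \<le> c \<Longrightarrow> q (c *\<^sub>R x) = c * q x"
  by (simp add: sublinear_def)

lemma sublinear_0: "sublinear q \<Longrightarrow> q 0 = 0"
  using sublinear_scaleR[of q 0 0] by simp

lemma sublinear_ge_uminus: "sublinear q \<Longrightarrow> - q (- x) \<le> q x"
  using sublinear_add[of q x "- x"] sublinear_0[of q] by simp

lemma sublinearI:
  assumes add: "\<And>x y. q (x + y) \<le> q x + q y"
    and zero: "q 0 = 0"
    and le: "\<And>c x. 0 < c \<Longrightarrow> q (c *\<^sub>R x) \<le> c * q x"
  shows "sublinear q"
  unfolding sublinear_def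
proof (intro conjI allI impI add)
  fix c :: real and x
  assume "0 \<le> c"
  show "q (c *\<^sub>R x) = c * q x"
  proof (cases "c = 0")
    case False
    with \<open>0 \<le> c\<close> have c: "0 < c" by simp
    have "q (inverse c *\<^sub>R (c *\<^sub>R x)) \<le> inverse c * q (c *\<^sub>R x)"
      using c by (intro le) simp
    with c have "c * q x \<le> q (c *\<^sub>R x)" by (simp add: field_simps)
    with le[OF c, of x] show ?thesis by simp
  qed (simp add: zero)
qed

text \<open>
  For sublinear \<^term>\<open>q\<close>, this is the largest sublinear functional below \<^term>\<open>q\<close> whose value at \<^term>\<open>- y\<close> is at most
  \<^term>\<open>- q y\<close>.
\<close>

definition tilt :: "('a::real_vector \<Rightarrow> real) \<Rightarrow> 'a \<Rightarrow> 'a \<Rightarrow> real"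
  where "tilt q y x = (INF t\<in>{0..}. q (x + t *\<^sub>R y) - t * q y)"

lemma
  assumes q: "sublinear q"
  shows tilt_le: "0 \<le> t \<Longrightarrow> tilt q y x \<le> q (x + t *\<^sub>R y) - t * q y"
    and tilt_sublinear: "sublinear (tilt q y)"
proof -
  have bdd: "bdd_below ((\<lambda>t. q (x + t *\<^sub>R y) - t * q y) ` {0..})" for x
  proof (rule bdd_belowI2)
    fix t :: real
    assume "t \<in> {0..}"
    then show "- q (- x) \<le> q (x + t *\<^sub>R y) - t * q y"
      using sublinear_add[OF q, of "x + t *\<^sub>R y" "- x"] sublinear_scaleR[OF q, of t y] by simp
  qed
  show upper: "tilt q y x \<le> q (x + t *\<^sub>R y) - t * q y" if "0 \<le> t" for t x
    unfolding tilt_def using that by (intro cINF_lower bdd) simp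
  have least: "c \<le> tilt q y x" if "\<And>t. 0 \<le> t \<Longrightarrow> c \<le> q (x + t *\<^sub>R y) - t * q y" for c x
    unfolding tilt_def using that by (intro cINF_greatest) auto
  show "sublinear (tilt q y)"
  proof (rule sublinearI)
    show "tilt q y 0 = 0"
      using upper[of 0 0] least[of 0 0] sublinear_scaleR[OF q]
      by (intro antisym) (simp_all add: sublinear_0[OF q])
  next
    fix x x'
    have "tilt q y (x + x') - tilt q y x' \<le> tilt q y x"
    proof (rule least)
      fix s :: real assume s: "0 \<le> s"
      have "tilt q y (x + x') - (q (x + s *\<^sub>R y) - s * q y) \<le> tilt q y x'"
      proof (rule least)
        fix t :: real assume t: "0 \<le> t"
        have "tilt q y (x + x') \<le> q ((x + x') + (s + t) *\<^sub>R y) - (s + t) * q y"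
          using s t by (intro upper) simp
        also have "(x + x') + (s + t) *\<^sub>R y = (x + s *\<^sub>R y) + (x' + t *\<^sub>R y)"
          by (simp add: algebra_simps)
        also have "q \<dots> - (s + t) * q y
            \<le> (q (x + s *\<^sub>R y) + q (x' + t *\<^sub>R y)) - (s + t) * q y"
          using sublinear_add[OF q] by (intro diff_right_mono)
        finally show "tilt q y (x + x') - (q (x + s *\<^sub>R y) - s * q y)
            \<le> q (x' + t *\<^sub>R y) - t * q y"
          by (simp add: algebra_simps)
      qed
      then show "tilt q y (x + x') - tilt q y x' \<le> q (x + s *\<^sub>R y) - s * q y" by simp
    qed
    then show "tilt q y (x + x') \<le> tilt q y x + tilt q y x'" by simp
  next
    fix c :: real and x
    assume c: "0 < c"
    have "tilt q y (c *\<^sub>R x) / c \<le> tilt q y x"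
    proof (rule least)
      fix t :: real assume t: "0 \<le> t"
      have "tilt q y (c *\<^sub>R x) \<le> q (c *\<^sub>R x + (c * t) *\<^sub>R y) - (c * t) * q y"
        using c t by (intro upper) simp
      also have "c *\<^sub>R x + (c * t) *\<^sub>R y = c *\<^sub>R (x + t *\<^sub>R y)"
        by (simp add: algebra_simps)
      finally show "tilt q y (c *\<^sub>R x) / c \<le> q (x + t *\<^sub>R y) - t * q y"
        using c sublinear_scaleR[OF q, of c "x + t *\<^sub>R y"] by (simp add: field_simps)
    qed
    with c show "tilt q y (c *\<^sub>R x) \<le> c * tilt q y x" by (simp add: field_simps)
  qed
qed

text \<open>
  The chain condition gives subadditivity: the smaller of two members estimates the infimum at
  \<^term>\<open>x + y\<close>. Finiteness of the infimum comes from \<^term>\<open>- p (- x) \<le> q x\<close>.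
\<close>

lemma INF_chain_sublinear:
  fixes p :: "'a::real_vector \<Rightarrow> real"
  assumes ne: "C \<noteq> {}"
    and subC: "\<forall>q\<in>C. sublinear q \<and> (\<forall>x. q x \<le> p x)"
    and chainC: "\<forall>q\<in>C. \<forall>r\<in>C. (\<forall>x. q x \<le> r x) \<or> (\<forall>x. r x \<le> q x)"
  shows "sublinear (\<lambda>x. INF q\<in>C. q x)" and "\<And>q x. q \<in> C \<Longrightarrow> (INF q\<in>C. q x) \<le> q x"
proof -
  note C = bspec[OF subC] and chain = bspec[OF bspec[OF chainC]]
  have bdd: "bdd_below ((\<lambda>q. q x) ` C)" for x
  proof (rule bdd_belowI2)
    fix q assume "q \<in> C"
    then show "- p (- x) \<le> q x"
      using C[of q] sublinear_ge_uminus[of q x] by (auto intro: order_trans[of _ "- q (- x)"])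
  qed
  show lower: "(INF q\<in>C. q x) \<le> q x" if "q \<in> C" for q x
    using that by (intro cINF_lower bdd)
  have greatest: "c \<le> (INF q\<in>C. q x)" if "\<And>q. q \<in> C \<Longrightarrow> c \<le> q x" for c x
    using ne that by (intro cINF_greatest)
  show "sublinear (\<lambda>x. INF q\<in>C. q x)"
  proof (rule sublinearI)
    have "(\<lambda>q. q 0) ` C = {0}" using ne C sublinear_0 by fastforce
    then show "(INF q\<in>C. q 0) = 0" by simp
  next
    fix x y
    have "(INF q\<in>C. q (x + y)) - (INF q\<in>C. q y) \<le> (INF q\<in>C. q x)"
    proof (rule greatest)
      fix q assume q: "q \<in> C"
      have "(INF q\<in>C. q (x + y)) - q x \<le> (INF q\<in>C. q y)"
      proof (rule greatest)
        fix r assume r: "r \<in> C"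
        from chain[OF q r] obtain s where s: "s \<in> C" "\<And>x. s x \<le> q x" "\<And>x. s x \<le> r x"
          using q r by blast
        have "(INF q\<in>C. q (x + y)) \<le> s (x + y)" using s by (intro lower)
        also have "\<dots> \<le> s x + s y" using C s by (intro sublinear_add) auto
        also have "\<dots> \<le> q x + r y" using s by (intro add_mono)
        finally show "(INF q\<in>C. q (x + y)) - q x \<le> r y" by simp
      qed
      then show "(INF q\<in>C. q (x + y)) - (INF q\<in>C. q y) \<le> q x" by simp
    qed
    then show "(INF q\<in>C. q (x + y)) \<le> (INF q\<in>C. q x) + (INF q\<in>C. q y)" by simp
  next
    fix c :: real and x
    assume c: "0 < c"
    have "(INF q\<in>C. q (c *\<^sub>R x)) / c \<le> (INF q\<in>C. q x)"
    proof (rule greatest)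
      fix q assume q: "q \<in> C"
      with lower[OF q, of "c *\<^sub>R x"] C[OF q] c
      show "(INF q\<in>C. q (c *\<^sub>R x)) / c \<le> q x"
        by (simp add: sublinear_scaleR field_simps)
    qed
    with c show "(INF q\<in>C. q (c *\<^sub>R x)) \<le> c * (INF q\<in>C. q x)" by (simp add: field_simps)
  qed
qed

text \<open>
  Hahn-Banach in the form that a sublinear functional dominates a linear one. A minimal sublinear
  functional equals each of its tilts, and this forces additivity.
\<close>

lemma sublinear_dominates_linear:
  fixes p :: "'a::real_vector \<Rightarrow> real"
  assumes p: "sublinear p"
  obtains f :: "'a \<Rightarrow> real" where "linear f" "\<And>x. f x \<le> p x"
proof -
  define A where "A = {q. sublinear q \<and> (\<forall>x. q x \<le> p x)}"
  define P where "P = (\<lambda>q r :: 'a \<Rightarrow> real. \<forall>x. r x \<le> q x)"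
  have "\<exists>m\<in>A. \<forall>a\<in>A. P m a \<longrightarrow> a = m"
  proof (rule predicate_Zorn)
    show "partial_order_on A (relation_of P A)"
      by (rule partial_order_on_relation_ofI) (auto simp: P_def fun_eq_iff intro: order_trans antisym)
  next
    fix C assume C: "C \<in> Chains (relation_of P A)"
    then have CA: "\<forall>q\<in>C. sublinear q \<and> (\<forall>x. q x \<le> p x)"
      and chain: "\<forall>q\<in>C. \<forall>r\<in>C. (\<forall>x. q x \<le> r x) \<or> (\<forall>x. r x \<le> q x)"
      unfolding Chains_def relation_of_def A_def P_def by blast+
    show "\<exists>u\<in>A. \<forall>a\<in>C. P a u"
    proof (cases "C = {}")
      case True
      with p show ?thesis by (auto simp: A_def)
    next
      case False
      note sub = INF_chain_sublinear(1)[OF False CA chain]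
      note lower = INF_chain_sublinear(2)[OF False CA chain]
      from False obtain q where q: "q \<in> C" by blast
      have "(INF q\<in>C. q x) \<le> p x" for x
        using lower[OF q, of x] bspec[OF CA q] order_trans[of _ "q x" "p x"] by blast
      with sub have "(\<lambda>x. INF q\<in>C. q x) \<in> A" by (simp add: A_def)
      moreover have "\<forall>q\<in>C. P q (\<lambda>x. INF q\<in>C. q x)" using lower by (simp add: P_def)
      ultimately show ?thesis by (intro bexI)
    qed
  qed
  then obtain m where mA: "m \<in> A" and minA: "\<And>q. q \<in> A \<Longrightarrow> P m q \<Longrightarrow> q = m" by blast
  then have m: "sublinear m" "m x \<le> p x" for x by (simp_all add: A_def)
  have min: "q = m" if "sublinear q" "\<And>x. q x \<le> m x" for q
    using that m(2) by (intro minA) (auto simp: A_def P_def intro: order_trans[of _ "m _"])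
  have "tilt m y = m" for y
    using tilt_le[OF m(1), of 0] by (intro min tilt_sublinear m(1)) simp
  then have "m x \<le> m (x + y) - m y" for x y
    using tilt_le[OF m(1), of 1 y x] by simp
  then have add: "m (x + y) = m x + m y" for x y
    using sublinear_add[OF m(1), of x y] by (smt (verit))
  have neg: "m (- x) = - m x" for x
    using add[of x "- x"] sublinear_0[OF m(1)] by simp
  have "m (c *\<^sub>R x) = c * m x" for c x
    using sublinear_scaleR[OF m(1), of c x] sublinear_scaleR[OF m(1), of "- c" x] neg[of "c *\<^sub>R x"]
    by (cases "0 \<le> c") auto
  with add have "linear m" by (intro linearI) auto
  with m(2) that show thesis by blast
qed

text \<open>
  A linear functional dominated by the tilt of the norm along \<^term>\<open>x\<close> is at most
  \<^term>\<open>- norm x\<close> at \<^term>\<open>- x\<close>, hence attains \<^term>\<open>norm x\<close> at \<^term>\<open>x\<close>.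
\<close>

lemma norming_functional:
  fixes x :: "'a::real_normed_vector"
  obtains f :: "'a \<Rightarrow>\<^sub>L real" where "norm f \<le> 1" "blinfun_apply f x = norm x"
proof -
  have norm: "sublinear (norm :: 'a \<Rightarrow> real)"
    by (simp add: sublinear_def norm_triangle_ineq)
  obtain f where f: "linear f" "\<And>z. f z \<le> tilt norm x z"
    using sublinear_dominates_linear[OF tilt_sublinear[OF norm]] by blast
  interpret f: linear f by (fact f(1))
  have le: "f z \<le> norm z" for z
    using f(2)[of z] tilt_le[OF norm, of 0 x z] by simp
  have abs: "norm (f z) \<le> norm z * 1" for z
    using le[of z] le[of "- z"] f.neg[of z] by (simp add: abs_le_iff)
  have bl: "bounded_linear f"
    by (rule bounded_linear_intro) (fact f.add f.scale abs)+
  have "f (- x) \<le> - norm x"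
    using f(2)[of "- x"] tilt_le[OF norm, of 1 x "- x"] by simp
  with le[of x] have fx: "f x = norm x" by (simp add: f.neg)
  show thesis
  proof
    show "norm (Blinfun f) \<le> 1"
      using abs by (intro norm_blinfun_bound) (simp_all add: bounded_linear_Blinfun_apply bl)
    show "blinfun_apply (Blinfun f) x = norm x"
      using fx by (simp add: bounded_linear_Blinfun_apply bl)
  qed
qed

text \<open>
  Points \<^term>\<open>a n\<close> of norm greater than \<^term>\<open>Suc n\<close> are detected by norming functionals divided by
  \<^term>\<open>Suc n\<close>, a sequence that converges to \<^term>\<open>0\<close> even in norm.
\<close>

lemma limited_imp_bounded:
  fixes A :: "'a::banach set"
  assumes "limited A"
  shows "bounded A"
proof (rule ccontr)
  assume "\<not> bounded A"
  then have "\<exists>a\<in>A. real (Suc n) < norm a" for n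
    unfolding bounded_iff by (metis not_le)
  then obtain a where a: "\<And>n. a n \<in> A" "\<And>n. real (Suc n) < norm (a n)" by metis
  have "\<exists>f :: 'a \<Rightarrow>\<^sub>L real. norm f \<le> 1 \<and> blinfun_apply f (a n) = norm (a n)" for n
    using norming_functional[of "a n"] by blast
  then obtain f :: "nat \<Rightarrow> 'a \<Rightarrow>\<^sub>L real"
    where f: "\<And>n. norm (f n) \<le> 1" "\<And>n. blinfun_apply (f n) (a n) = norm (a n)" by metis
  define g where "g n = inverse (real (Suc n)) *\<^sub>R f n" for n
  have "weak_star_null g"
    unfolding weak_star_null_def
  proof
    fix x
    have "norm (blinfun_apply (f n) x) \<le> norm x" for n
      using norm_blinfun[of "f n" x] mult_right_mono[OF f(1)[of n], of "norm x"] by simp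
    then have "norm (blinfun_apply (g n) x) \<le> inverse (real (Suc n)) * norm x" for n
      by (simp add: g_def blinfun.scaleR_left abs_mult)
    moreover have "(\<lambda>n. inverse (real (Suc n)) * norm x) \<longlonglongrightarrow> 0"
      using tendsto_mult_left_zero[OF LIMSEQ_inverse_real_of_nat] .
    ultimately show "(\<lambda>n. blinfun_apply (g n) x) \<longlonglongrightarrow> 0"
      by (rule Lim_null_comparison[OF always_eventually[OF allI]])
  qed
  with assms have "uniform_limit A (\<lambda>n. blinfun_apply (g n)) (\<lambda>_. 0) sequentially"
    by (simp add: limited_def)
  then have "\<forall>\<^sub>F n in sequentially. \<forall>x\<in>A. dist (blinfun_apply (g n) x) 0 < 1"
    by (rule uniform_limitD) simp
  then obtain n where "\<And>x. x \<in> A \<Longrightarrow> \<bar>blinfun_apply (g n) x\<bar> < 1"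
    by (auto simp: eventually_sequentially)
  from this[OF a(1), of n] a(2)[of n] show False
    by (simp add: g_def blinfun.scaleR_left f(2) field_simps)
qed

section \<open>Disjoint elements and components of positive functionals\<close>

lemma inf_add_le:
  fixes a b c :: "'a::lattice_ab_group_add"
  assumes "0 \<le> a" "0 \<le> b" "0 \<le> c"
  shows "inf (a + b) c \<le> inf a c + inf b c"
proof -
  have "inf (a + b) c \<le> inf (inf (a + b) (a + c)) (inf (c + b) (c + c))"
    using assms
    by (intro le_infI) (auto intro: le_infI1 le_infI2 add_increasing add_increasing2)
  also have "\<dots> = inf a c + inf b c"
    by (simp add: add_inf_distrib_left add_inf_distrib_right inf.assoc inf.left_commute inf.commute)
  finally show ?thesis .
qed

lemma inf_eq_0_mono:
  fixes u v :: "'a::lattice_ab_group_add"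
  assumes "inf u v = 0" "0 \<le> a" "a \<le> u" "0 \<le> b" "b \<le> v"
  shows "inf a b = 0"
  using assms inf_mono[of a u b v] by (intro antisym) auto

text \<open>
  Enlarging both factors to a common \<open>r\<close> can only increase the infimum, and dividing the infimum
  by \<open>r\<close> brings it below \<^term>\<open>inf u v\<close>.
\<close>

lemma inf_scaleR_eq_0:
  fixes u v :: "'a::banach_lattice"
  assumes uv: "inf u v = 0" and s: "0 \<le> s" and t: "0 \<le> t"
  shows "inf (s *\<^sub>R u) (t *\<^sub>R v) = 0"
proof -
  have u: "0 \<le> u" and v: "0 \<le> v" using uv by (metis inf_le1, metis inf_le2)
  define r where "r = max 1 (max s t)"
  have r: "0 < r" "s \<le> r" "t \<le> r" by (auto simp: r_def)
  let ?i = "inf (s *\<^sub>R u) (t *\<^sub>R v)"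
  have "?i \<le> r *\<^sub>R u" "?i \<le> r *\<^sub>R v"
    using r u v by (auto intro: le_infI1 le_infI2 scaleR_right_mono)
  then have "inverse r *\<^sub>R ?i \<le> inverse r *\<^sub>R (r *\<^sub>R u)" "inverse r *\<^sub>R ?i \<le> inverse r *\<^sub>R (r *\<^sub>R v)"
    using r by (auto intro!: scaleR_left_mono simp del: scaleR_scaleR)
  then have "inverse r *\<^sub>R ?i \<le> inf u v" using r by simp
  then have "r *\<^sub>R (inverse r *\<^sub>R ?i) \<le> r *\<^sub>R 0"
    using r unfolding uv by (intro scaleR_left_mono) auto
  then have "?i \<le> 0" using r by simp
  moreover have "0 \<le> ?i" using u v s t by (auto intro: scaleR_nonneg_nonneg)
  ultimately show ?thesis by (rule antisym)
qed

lemma inf_pprt_uminus: "inf (pprt x) (pprt (- x)) = 0" for x :: "'a::lattice_ab_group_add"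
proof -
  have "inf (pprt x) (pprt (- x)) = pprt (- x) + inf (pprt x - pprt (- x)) 0"
    by (simp add: add_inf_distrib_left)
  also have "pprt x - pprt (- x) = x" using prts[of x] by (simp add: pprt_neg)
  also have "inf x 0 = - pprt (- x)" by (simp add: pprt_neg nprt_def)
  finally show ?thesis by simp
qed

lemma blinfun_le_iff: "f \<le> g \<longleftrightarrow> (\<forall>x\<ge>0. blinfun_apply f x \<le> blinfun_apply g x)"
  for f g :: "'a::banach_lattice \<Rightarrow>\<^sub>L real"
  by (rule less_eq_blinfun_def)

lemma blinfun_nonneg_iff: "0 \<le> f \<longleftrightarrow> (\<forall>x\<ge>0. 0 \<le> blinfun_apply f x)"
  for f :: "'a::banach_lattice \<Rightarrow>\<^sub>L real"
  by (simp add: blinfun_le_iff)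

lemma blinfun_nonneg_mono: "0 \<le> f \<Longrightarrow> x \<le> y \<Longrightarrow> blinfun_apply f x \<le> blinfun_apply f y"
  for f :: "'a::banach_lattice \<Rightarrow>\<^sub>L real"
  using blinfun_nonneg_iff[of f] by (metis blinfun.diff_right diff_ge_0_iff_ge)

lemma abs_blinfun_apply_le: "0 \<le> x \<Longrightarrow> \<bar>blinfun_apply f x\<bar> \<le> blinfun_apply \<bar>f\<bar> x"
  for f :: "'a::banach_lattice \<Rightarrow>\<^sub>L real"
proof -
  assume x: "0 \<le> x"
  have "f \<le> \<bar>f\<bar>" "- f \<le> \<bar>f\<bar>" by (rule abs_ge_self abs_ge_minus_self)+
  with x have "blinfun_apply f x \<le> blinfun_apply \<bar>f\<bar> x"
      "blinfun_apply (- f) x \<le> blinfun_apply \<bar>f\<bar> x"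
    unfolding blinfun_le_iff by blast+
  then show ?thesis by (simp add: blinfun.minus_left abs_le_iff)
qed

text \<open>
  The Riesz-Kantorovich formula gives \<open>\<bar>f\<bar> x\<close> as the supremum of \<^term>\<open>f y - f (x - y)\<close>. Writing
  this as \<^term>\<open>2 * f y - f x\<close> leaves only evaluations at elements of the interval from
  \<^term>\<open>0\<close> to \<^term>\<open>x\<close>, so that disjointness and order bounds pass on to the arguments of
  \<^term>\<open>f\<close>.
\<close>

lemma abs_blinfun_approx:
  fixes f :: "'a::banach_lattice \<Rightarrow>\<^sub>L real"
  assumes x: "0 \<le> x" and e: "0 < e"
  obtains y where "0 \<le> y" "y \<le> x"
    "blinfun_apply \<bar>f\<bar> x < 2 * blinfun_apply f y - blinfun_apply f x + e"
proof -
  have "blinfun_apply \<bar>f\<bar> x = rk f (- f) x"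
    using x by (simp add: abs_blinfun_def sup_blinfun_apply_nonneg)
  moreover have "c < rk f (- f) x
      \<longleftrightarrow> (\<exists>y\<in>{0..x}. c < blinfun_apply f y + blinfun_apply (- f) (x - y))" for c
    unfolding rk_def using x by (intro less_cSUP_iff rk_bdd) auto
  from this[of "blinfun_apply \<bar>f\<bar> x - e"] obtain y where "0 \<le> y" "y \<le> x"
      "blinfun_apply \<bar>f\<bar> x - e < blinfun_apply f y + blinfun_apply (- f) (x - y)"
    using calculation e by auto
  then show thesis
    by (intro that[of y]) (simp_all add: blinfun.bilinear_simps)
qed

text \<open>
  Dual form of the Riesz-Kantorovich formula: the infimum at \<^term>\<open>x\<close> is at most
  \<^term>\<open>f y + g (x - y)\<close> for every splitting of \<^term>\<open>x\<close>.
\<close>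

lemma inf_blinfun_eq_0:
  fixes f g :: "'a::banach_lattice \<Rightarrow>\<^sub>L real"
  assumes f: "0 \<le> f" and g: "0 \<le> g"
    and split: "\<And>x e. 0 \<le> x \<Longrightarrow> 0 < e
      \<Longrightarrow> \<exists>y. 0 \<le> y \<and> y \<le> x \<and> blinfun_apply f y + blinfun_apply g (x - y) \<le> e"
  shows "inf f g = 0"
proof (rule antisym)
  show "inf f g \<le> 0"
    unfolding blinfun_le_iff
  proof (intro allI impI, rule field_le_epsilon)
    fix x :: 'a and e :: real
    assume x: "0 \<le> x" and "0 < e"
    from split[OF this] obtain y where y: "0 \<le> y" "y \<le> x"
      "blinfun_apply f y + blinfun_apply g (x - y) \<le> e" by blast
    have "blinfun_apply (inf f g) y \<le> blinfun_apply f y"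
        "blinfun_apply (inf f g) (x - y) \<le> blinfun_apply g (x - y)"
      using y inf_le1[of f g] inf_le2[of f g] unfolding blinfun_le_iff by auto
    with y(3) show "blinfun_apply (inf f g) x \<le> blinfun_apply 0 x + e"
      by (simp add: blinfun.diff_right)
  qed
  show "0 \<le> inf f g" using f g by simp
qed

lemma positive_functional_extension:
  fixes k :: "'a::banach_lattice \<Rightarrow> real"
  assumes add: "\<And>x y. 0 \<le> x \<Longrightarrow> 0 \<le> y \<Longrightarrow> k (x + y) = k x + k y"
    and scale: "\<And>c x. 0 < c \<Longrightarrow> 0 \<le> x \<Longrightarrow> k (c *\<^sub>R x) = c * k x"
    and bound: "\<And>x. 0 \<le> x \<Longrightarrow> \<bar>k x\<bar> \<le> norm x * B"
  obtains g :: "'a \<Rightarrow>\<^sub>L real" where "\<And>x. 0 \<le> x \<Longrightarrow> blinfun_apply g x = k x"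
proof -
  define F where "F x = k (pprt x) - k (- nprt x)" for x
  have F_diff: "F (a - b) = k a - k b" if "0 \<le> a" "0 \<le> b" for a b
  proof -
    have "pprt (a - b) + b = a + (- nprt (a - b))"
      using prts[of "a - b"] by (simp add: algebra_simps)
    then have "k (pprt (a - b)) + k b = k a + k (- nprt (a - b))"
      using that by (metis add zero_le_pprt neg_0_le_iff_le nprt_le_zero)
    then show ?thesis by (simp add: F_def)
  qed
  have parts: "x = pprt x - (- nprt x)" for x :: 'a using prts[of x] by simp
  have k0: "k 0 = 0" using add[of 0 0] by simp
  have F_neg: "F (- x) = - F x" for x by (simp add: F_def pprt_neg nprt_neg)
  have F_scale: "F (c *\<^sub>R x) = c * F x" if c: "0 < c" for c x
  proof -
    have "F (c *\<^sub>R x) = F (c *\<^sub>R pprt x - c *\<^sub>R (- nprt x))"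
      using parts[of x] by (metis scaleR_diff_right)
    also have "\<dots> = k (c *\<^sub>R pprt x) - k (c *\<^sub>R (- nprt x))"
      using c by (intro F_diff scaleR_nonneg_nonneg) auto
    also have "\<dots> = c * F x"
      using c by (subst (1 2) scale) (auto simp: F_def right_diff_distrib)
    finally show ?thesis .
  qed
  have "bounded_linear F"
  proof (rule bounded_linear_intro)
    fix x y :: 'a
    have "F (x + y) = F ((pprt x + pprt y) - (- nprt x + - nprt y))"
      using parts[of x] parts[of y] by (metis add_diff_add)
    also have "\<dots> = k (pprt x + pprt y) - k (- nprt x + - nprt y)"
      by (intro F_diff add_nonneg_nonneg) auto
    also have "\<dots> = F x + F y"
      by (subst (1 2) add) (auto simp: F_def)
    finally show "F (x + y) = F x + F y" .
  next
    fix c :: real and x :: 'a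
    consider "0 < c" | "c = 0" | "0 < - c" by linarith
    then show "F (c *\<^sub>R x) = c *\<^sub>R F x"
      using F_scale[of c x] F_scale[of "- c" x] F_neg[of "c *\<^sub>R x"]
      by cases (auto simp: F_def k0)
  next
    fix x :: 'a
    have "\<bar>k (pprt x)\<bar> \<le> norm (pprt x) * \<bar>B\<bar>" "\<bar>k (- nprt x)\<bar> \<le> norm (- nprt x) * \<bar>B\<bar>"
      using bound[of "pprt x"] bound[of "- nprt x"]
      by (auto intro: order_trans[OF _ mult_left_mono[OF abs_ge_self]] simp del: norm_minus_cancel)
    moreover have "pprt x \<le> \<bar>x\<bar>" "- nprt x \<le> \<bar>x\<bar>" by (simp_all add: abs_prts)
    then have "norm (pprt x) \<le> norm x" "norm (- nprt x) \<le> norm x"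
      using norm_mono_nonneg[of "pprt x" "\<bar>x\<bar>"] norm_mono_nonneg[of "- nprt x" "\<bar>x\<bar>"] by auto
    then have "norm (pprt x) * \<bar>B\<bar> \<le> norm x * \<bar>B\<bar>" "norm (- nprt x) * \<bar>B\<bar> \<le> norm x * \<bar>B\<bar>"
      by (simp_all add: mult_right_mono del: norm_minus_cancel)
    ultimately show "norm (F x) \<le> norm x * (2 * \<bar>B\<bar>)"
      unfolding F_def real_norm_def by linarith
  qed
  moreover have "F x = k x" if "0 \<le> x" for x
    using F_diff[of x 0] that k0 by simp
  ultimately show thesis
    using that[of "Blinfun F"] by (simp add: bounded_linear_Blinfun_apply)
qed

text \<open>
  The value at \<^term>\<open>x \<ge> 0\<close> of the component of a positive functional in the band generated by
  \<^term>\<open>u\<close>. The supremum is formed in the reals, so it exists in every Banach lattice. For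
  a band projection \<open>P\<close> onto that band and an order continuous \<^term>\<open>\<phi>\<close> it would be
  \<open>\<phi> (P x)\<close>.
\<close>

definition component_value :: "('a::banach_lattice \<Rightarrow>\<^sub>L real) \<Rightarrow> 'a \<Rightarrow> 'a \<Rightarrow> real"
  where "component_value \<phi> u x = (SUP t\<in>{0..}. blinfun_apply \<phi> (inf x (t *\<^sub>R u)))"

context
  fixes \<phi> :: "'a::banach_lattice \<Rightarrow>\<^sub>L real" and u :: 'a
  assumes \<phi>: "0 \<le> \<phi>" and u: "0 \<le> u"
begin

lemma component_value_upper:
  assumes t: "0 \<le> t"
  shows "blinfun_apply \<phi> (inf x (t *\<^sub>R u)) \<le> component_value \<phi> u x"
  unfolding component_value_def
proof (rule cSUP_upper)
  show "bdd_above ((\<lambda>t. blinfun_apply \<phi> (inf x (t *\<^sub>R u))) ` {0..})"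
    by (intro bdd_aboveI2[of _ _ "blinfun_apply \<phi> x"] blinfun_nonneg_mono \<phi>) simp
qed (use t in simp)

lemma component_value_least:
  assumes "\<And>t. 0 \<le> t \<Longrightarrow> blinfun_apply \<phi> (inf x (t *\<^sub>R u)) \<le> c"
  shows "component_value \<phi> u x \<le> c"
  unfolding component_value_def using assms by (intro cSUP_least) auto

lemma component_value_nonneg:
  assumes "0 \<le> x" shows "0 \<le> component_value \<phi> u x"
  using component_value_upper[of 0 x] assms by (simp add: inf_absorb2)

lemma component_value_add:
  assumes x: "0 \<le> x" and y: "0 \<le> y"
  shows "component_value \<phi> u (x + y) = component_value \<phi> u x + component_value \<phi> u y"
proof (rule antisym)
  show "component_value \<phi> u (x + y) \<le> component_value \<phi> u x + component_value \<phi> u y"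
  proof (rule component_value_least)
    fix t :: real assume t: "0 \<le> t"
    have "blinfun_apply \<phi> (inf (x + y) (t *\<^sub>R u))
        \<le> blinfun_apply \<phi> (inf x (t *\<^sub>R u) + inf y (t *\<^sub>R u))"
      using x y u t by (intro blinfun_nonneg_mono \<phi> inf_add_le) (auto intro: scaleR_nonneg_nonneg)
    also have "\<dots> \<le> component_value \<phi> u x + component_value \<phi> u y"
      unfolding blinfun.add_right using t by (intro add_mono component_value_upper)
    finally show "blinfun_apply \<phi> (inf (x + y) (t *\<^sub>R u))
        \<le> component_value \<phi> u x + component_value \<phi> u y" .
  qed
  have "component_value \<phi> u x \<le> component_value \<phi> u (x + y) - component_value \<phi> u y"
  proof (rule component_value_least)
    fix s :: real assume s: "0 \<le> s"
    have "component_value \<phi> u y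
        \<le> component_value \<phi> u (x + y) - blinfun_apply \<phi> (inf x (s *\<^sub>R u))"
    proof (rule component_value_least)
      fix t :: real assume t: "0 \<le> t"
      have "inf x (s *\<^sub>R u) + inf y (t *\<^sub>R u) \<le> inf (x + y) ((s + t) *\<^sub>R u)"
        unfolding scaleR_add_left by (intro le_infI add_mono) auto
      then have "blinfun_apply \<phi> (inf x (s *\<^sub>R u) + inf y (t *\<^sub>R u))
          \<le> blinfun_apply \<phi> (inf (x + y) ((s + t) *\<^sub>R u))"
        by (rule blinfun_nonneg_mono[OF \<phi>])
      also have "\<dots> \<le> component_value \<phi> u (x + y)"
        using s t by (intro component_value_upper) simp
      finally show "blinfun_apply \<phi> (inf y (t *\<^sub>R u))
          \<le> component_value \<phi> u (x + y) - blinfun_apply \<phi> (inf x (s *\<^sub>R u))"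
        by (simp add: blinfun.add_right)
    qed
    then show "blinfun_apply \<phi> (inf x (s *\<^sub>R u))
        \<le> component_value \<phi> u (x + y) - component_value \<phi> u y" by simp
  qed
  then show "component_value \<phi> u x + component_value \<phi> u y \<le> component_value \<phi> u (x + y)"
    by simp
qed

lemma component_value_scaleR_le:
  assumes c: "0 < c"
  shows "component_value \<phi> u (c *\<^sub>R x) \<le> c * component_value \<phi> u x"
proof (rule component_value_least)
  fix t :: real assume t: "0 \<le> t"
  let ?i = "inf (c *\<^sub>R x) (t *\<^sub>R u)"
  have "inverse c *\<^sub>R ?i \<le> inverse c *\<^sub>R (c *\<^sub>R x)" "inverse c *\<^sub>R ?i \<le> inverse c *\<^sub>R (t *\<^sub>R u)"
    using c by (auto intro!: scaleR_left_mono simp del: scaleR_scaleR)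
  then have "inverse c *\<^sub>R ?i \<le> inf x ((inverse c * t) *\<^sub>R u)"
    using c by simp
  then have "blinfun_apply \<phi> (inverse c *\<^sub>R ?i) \<le> blinfun_apply \<phi> (inf x ((inverse c * t) *\<^sub>R u))"
    by (rule blinfun_nonneg_mono[OF \<phi>])
  also have "\<dots> \<le> component_value \<phi> u x"
    using c t by (intro component_value_upper) simp
  finally show "blinfun_apply \<phi> ?i \<le> c * component_value \<phi> u x"
    using c by (simp add: blinfun.scaleR_right field_simps)
qed

lemma component_value_scaleR:
  assumes c: "0 < c"
  shows "component_value \<phi> u (c *\<^sub>R x) = c * component_value \<phi> u x"
proof (rule antisym[OF component_value_scaleR_le[OF c]])
  show "c * component_value \<phi> u x \<le> component_value \<phi> u (c *\<^sub>R x)"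
    using component_value_scaleR_le[of "inverse c" "c *\<^sub>R x"] c by (simp add: field_simps)
qed

lemma ex_component:
  "\<exists>g :: 'a \<Rightarrow>\<^sub>L real. \<forall>x\<ge>0. blinfun_apply g x = component_value \<phi> u x"
proof (rule positive_functional_extension[of "component_value \<phi> u" "norm \<phi>"])
  fix x :: 'a assume x: "0 \<le> x"
  have "component_value \<phi> u x \<le> blinfun_apply \<phi> x"
    by (intro component_value_least blinfun_nonneg_mono \<phi>) simp
  also have "\<dots> \<le> norm x * norm \<phi>"
    using norm_blinfun[of \<phi> x] by (simp add: mult.commute)
  finally show "\<bar>component_value \<phi> u x\<bar> \<le> norm x * norm \<phi>"
    using component_value_nonneg[OF x] by simp
qed (auto simp: component_value_add component_value_scaleR)

end

definition component :: "('a::banach_lattice \<Rightarrow>\<^sub>L real) \<Rightarrow> 'a \<Rightarrow> 'a \<Rightarrow>\<^sub>L real"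
  where "component \<phi> u = (SOME g. \<forall>x\<ge>0. blinfun_apply g x = component_value \<phi> u x)"

context
  fixes \<phi> :: "'a::banach_lattice \<Rightarrow>\<^sub>L real" and u :: 'a
  assumes \<phi>: "0 \<le> \<phi>" and u: "0 \<le> u"
begin

lemma component_apply: "0 \<le> x \<Longrightarrow> blinfun_apply (component \<phi> u) x = component_value \<phi> u x"
  using someI_ex[OF ex_component[OF \<phi> u]] by (simp add: component_def)

lemma component_nonneg: "0 \<le> component \<phi> u"
  unfolding blinfun_nonneg_iff
  by (auto simp: component_apply component_value_nonneg[OF \<phi> u])

lemma component_approx:
  assumes x: "0 \<le> x" and e: "0 < e"
  obtains t where "0 \<le> t"
    "blinfun_apply (component \<phi> u) x < blinfun_apply \<phi> (inf x (t *\<^sub>R u)) + e"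
proof -
  have "\<exists>t\<ge>0. component_value \<phi> u x - e < blinfun_apply \<phi> (inf x (t *\<^sub>R u))"
  proof (rule ccontr)
    assume "\<not> ?thesis"
    then have "component_value \<phi> u x \<le> component_value \<phi> u x - e"
      by (intro component_value_least[OF \<phi> u]) (auto simp: not_less)
    with e show False by simp
  qed
  with that x show thesis by (auto simp: component_apply)
qed

lemma component_eq_on_band:
  assumes x: "0 \<le> x" "x \<le> t *\<^sub>R u" and t: "0 \<le> t"
  shows "blinfun_apply (component \<phi> u) x = blinfun_apply \<phi> x"
proof (rule antisym)
  show "blinfun_apply (component \<phi> u) x \<le> blinfun_apply \<phi> x"
    unfolding component_apply[OF x(1)]
    by (intro component_value_least[OF \<phi> u] blinfun_nonneg_mono \<phi>) simp
  show "blinfun_apply \<phi> x \<le> blinfun_apply (component \<phi> u) x"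
    using component_value_upper[OF \<phi> u t, of x] x by (simp add: component_apply inf_absorb1)
qed

lemma component_eq_0:
  assumes "inf u v = 0"
  shows "blinfun_apply (component \<phi> u) v = 0"
proof -
  have v: "0 \<le> v" using assms by (metis inf_le2)
  have "inf v (t *\<^sub>R u) = 0" if "0 \<le> t" for t
    using inf_scaleR_eq_0[OF assms that, of 1] by (simp add: inf.commute)
  then have "component_value \<phi> u v \<le> 0"
    by (intro component_value_least[OF \<phi> u]) simp
  with component_value_nonneg[OF \<phi> u v] v show ?thesis by (simp add: component_apply)
qed

end

text \<open>
  Split \<^term>\<open>x\<close> into \<^term>\<open>inf x (t *\<^sub>R u)\<close> and the rest. For large \<^term>\<open>t\<close> the rest is almost
  invisible to \<^term>\<open>component \<phi> u\<close>, while the first part is disjoint from \<^term>\<open>v\<close>, so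
  \<^term>\<open>component \<psi> v\<close> vanishes there.
\<close>

lemma inf_component_eq_0:
  fixes \<phi> \<psi> :: "'a::banach_lattice \<Rightarrow>\<^sub>L real"
  assumes \<phi>: "0 \<le> \<phi>" and \<psi>: "0 \<le> \<psi>" and uv: "inf u v = 0"
  shows "inf (component \<phi> u) (component \<psi> v) = 0"
proof (rule inf_blinfun_eq_0)
  have u: "0 \<le> u" and v: "0 \<le> v" using uv by (metis inf_le1, metis inf_le2)
  show "0 \<le> component \<phi> u" "0 \<le> component \<psi> v"
    by (intro component_nonneg \<phi> \<psi> u v)+
  fix x :: 'a and e :: real
  assume x: "0 \<le> x" and e: "0 < e"
  obtain t where t: "0 \<le> t" "blinfun_apply (component \<phi> u) x < blinfun_apply \<phi> (inf x (t *\<^sub>R u)) + e"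
    using component_approx[OF \<phi> u x e] .
  let ?z = "inf x (t *\<^sub>R u)"
  have z: "0 \<le> ?z" "?z \<le> t *\<^sub>R u" using x t u by (auto intro: scaleR_nonneg_nonneg)
  have "blinfun_apply (component \<phi> u) ?z = blinfun_apply \<phi> ?z"
    by (rule component_eq_on_band[OF \<phi> u z t(1)])
  moreover have "inf v ?z = 0"
    using inf_scaleR_eq_0[OF uv t(1), of 1] inf_eq_0_mono[of "t *\<^sub>R u" v ?z v] z v
    by (simp add: inf.commute)
  then have "blinfun_apply (component \<psi> v) ?z = 0"
    by (rule component_eq_0[OF \<psi> v])
  ultimately show "\<exists>y. 0 \<le> y \<and> y \<le> x \<and>
      blinfun_apply (component \<phi> u) y + blinfun_apply (component \<psi> v) (x - y) \<le> e"
    using t x z(1) by (intro exI[of _ "x - ?z"]) (simp add: blinfun.diff_right del: diff_inf_eq_sup)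
qed

section \<open>Phillips' lemma\<close>

text \<open>
  Of two disjoint infinite subsets of \<^term>\<open>M\<close>, one has at most half the measure of \<^term>\<open>M\<close>;
  iterate.
\<close>

lemma infinite_subset_of_small_measure:
  fixes \<nu> :: "nat set \<Rightarrow> real"
  assumes add: "\<And>A B. A \<inter> B = {} \<Longrightarrow> \<nu> (A \<union> B) = \<nu> A + \<nu> B"
    and nonneg: "\<And>A. 0 \<le> \<nu> A"
    and M: "infinite M" and e: "0 < e"
  obtains M' where "M' \<subseteq> M" "infinite M'" "\<nu> M' < e"
proof -
  have mono: "\<nu> A \<le> \<nu> B" if "A \<subseteq> B" for A B
    using add[of A "B - A"] nonneg[of "B - A"] that by (simp add: Un_absorb1)
  have half: "\<exists>M'\<subseteq>M. infinite M' \<and> \<nu> M' \<le> \<nu> M / 2" if "infinite M" for M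
  proof -
    from that obtain C :: "nat \<Rightarrow> nat set" where C: "pairwise (\<lambda>i j. disjnt (C i) (C j)) UNIV"
      "(\<Union>i. C i) \<subseteq> M" "\<And>i. infinite (C i)"
      by (rule infinite_infinite_partition) blast
    have "C 0 \<inter> C 1 = {}" using C(1) by (auto simp: pairwise_def disjnt_def)
    then have "\<nu> (C 0) + \<nu> (C 1) \<le> \<nu> M"
      using add[of "C 0" "C 1"] mono[of "C 0 \<union> C 1" M] C(2) by auto
    then have "\<nu> (C 0) \<le> \<nu> M / 2 \<or> \<nu> (C 1) \<le> \<nu> M / 2" by linarith
    with C(2,3) show ?thesis by blast
  qed
  have pow: "\<exists>M'\<subseteq>M. infinite M' \<and> \<nu> M' \<le> \<nu> M / 2 ^ k" for k
  proof (induction k)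
    case 0
    show ?case using M by auto
  next
    case (Suc k)
    then obtain M1 where M1: "M1 \<subseteq> M" "infinite M1" "\<nu> M1 \<le> \<nu> M / 2 ^ k" by blast
    obtain M2 where M2: "M2 \<subseteq> M1" "infinite M2" "\<nu> M2 \<le> \<nu> M1 / 2"
      using half[OF M1(2)] by blast
    have "\<nu> M2 \<le> \<nu> M / 2 ^ Suc k" using M1(3) M2(3) by simp
    with M1 M2 show ?case by blast
  qed
  obtain k where "\<nu> M / e < 2 ^ k" using real_arch_pow[of 2 "\<nu> M / e"] by auto
  then have "\<nu> M / 2 ^ k < e" using e by (simp add: field_simps)
  with pow[of k] that show thesis by (meson order_le_less_trans)
qed

text \<open>
  A gliding hump. If \<^term>\<open>\<bar>\<mu> n {n}\<bar> \<ge> e\<close> for infinitely many \<^term>\<open>n\<close>, such indices can be chosen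
  one after the other so that \<^term>\<open>\<mu> n\<close> is small on the indices chosen before \<^term>\<open>n\<close>, by
  the limit hypothesis, and \<^term>\<open>\<nu> n\<close> is small on an infinite set to which all later indices are
  confined. On the set of all chosen indices these \<^term>\<open>\<mu> n\<close> then stay away from
  \<^term>\<open>0::real\<close>.
\<close>

lemma phillips_lemma:
  fixes \<mu> \<nu> :: "nat \<Rightarrow> nat set \<Rightarrow> real"
  assumes \<mu>_add: "\<And>n A B. A \<inter> B = {} \<Longrightarrow> \<mu> n (A \<union> B) = \<mu> n A + \<mu> n B"
    and \<nu>_add: "\<And>n A B. A \<inter> B = {} \<Longrightarrow> \<nu> n (A \<union> B) = \<nu> n A + \<nu> n B"
    and bound: "\<And>n A. \<bar>\<mu> n A\<bar> \<le> \<nu> n A"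
    and lim: "\<And>A. (\<lambda>n. \<mu> n A) \<longlonglongrightarrow> 0"
  shows "(\<lambda>n. \<mu> n {n}) \<longlonglongrightarrow> 0"
proof (rule ccontr)
  assume "\<not> ?thesis"
  then obtain e where e: "0 < e" and freq: "\<exists>\<^sub>F n in sequentially. \<not> dist (\<mu> n {n}) 0 < e"
    unfolding tendsto_iff frequently_def by auto
  define S where "S = {n. e \<le> \<bar>\<mu> n {n}\<bar>}"
  have S: "infinite S"
    using freq by (simp add: S_def frequently_cofinite cofinite_eq_sequentially[symmetric] not_less)
  have \<nu>0: "0 \<le> \<nu> n A" for n A using bound[of n A] by linarith
  have \<nu>_mono: "\<nu> n A \<le> \<nu> n B" if "A \<subseteq> B" for n A B
    using \<nu>_add[of A "B - A" n] \<nu>0[of n "B - A"] that by (simp add: Un_absorb1)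
  \<comment> \<open>A state consists of the indices \<^term>\<open>A\<close> chosen so far, the current index \<^term>\<open>n\<close>, and the
    reservoir \<^term>\<open>M\<close> for all later indices.\<close>
  define good where "good = (\<lambda>(A, n, M). finite A \<and> infinite M \<and> M \<subseteq> S \<and> n \<in> S \<and>
    n \<notin> A \<and> M \<inter> insert n A = {} \<and> \<bar>\<mu> n A\<bar> < e / 4 \<and> \<nu> n M < e / 4)"
  have step: "\<exists>n M'. n \<in> M \<and> N < n \<and> M' \<subseteq> M \<and> good (A, n, M')"
    if A: "finite A" and M: "infinite M" and MS: "M \<subseteq> S" and MA: "M \<inter> A = {}" for A M N
  proof -
    have "\<forall>\<^sub>F n in sequentially. dist (\<mu> n A) 0 < e / 4"
      using e by (intro tendstoD lim) simp
    then obtain N' where N': "\<And>n. N' \<le> n \<Longrightarrow> \<bar>\<mu> n A\<bar> < e / 4"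
      by (auto simp: eventually_sequentially)
    obtain n where n: "n \<in> M" "max N N' < n"
      using M by (metis infinite_nat_iff_unbounded)
    have "infinite (M - {n})" using M by simp
    then obtain M' where "M' \<subseteq> M - {n}" "infinite M'" "\<nu> n M' < e / 4"
      using infinite_subset_of_small_measure[of "\<nu> n" "M - {n}" "e / 4", OF \<nu>_add \<nu>0] e by auto
    with n N'[of n] A MS MA show ?thesis
      by (intro exI[of _ n] exI[of _ M']) (auto simp: good_def)
  qed
  define next_to where "next_to = (\<lambda>(A, n, M) (A', n', M').
    A' = insert n A \<and> n' \<in> M \<and> n < n' \<and> M' \<subseteq> (M :: nat set))"
  have "\<exists>s. \<forall>k. good (s k) \<and> next_to (s k) (s (Suc k))"
  proof (rule dependent_nat_choice)
    show "\<exists>s. good s" using step[of "{}" S 0] S by blast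
  next
    fix s assume "good s"
    obtain A n M where s: "s = (A, n, M)" by (cases s)
    have "finite (insert n A)" "infinite M" "M \<subseteq> S" "M \<inter> insert n A = {}"
      using \<open>good s\<close> by (simp_all add: s good_def)
    then have "\<exists>n' M'. n' \<in> M \<and> n < n' \<and> M' \<subseteq> M \<and> good (insert n A, n', M')"
      by (rule step)
    then show "\<exists>s'. good s' \<and> next_to s s'" by (force simp: s next_to_def)
  qed
  then obtain s where s: "\<And>k. good (s k)" "\<And>k. next_to (s k) (s (Suc k))" by blast
  define A n M where "A k = fst (s k)" and "n k = fst (snd (s k))" and "M k = snd (snd (s k))" for k
  have s_eq: "s k = (A k, n k, M k)" for k by (simp add: A_def n_def M_def)
  have good: "n k \<in> S" "n k \<notin> A k" "M k \<inter> insert (n k) (A k) = {}"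
    "\<bar>\<mu> (n k) (A k)\<bar> < e / 4" "\<nu> (n k) (M k) < e / 4" for k
    using s(1)[of k] by (auto simp: s_eq good_def)
  have nxt: "A (Suc k) = insert (n k) (A k)" "n (Suc k) \<in> M k" "n k < n (Suc k)" "M (Suc k) \<subseteq> M k" for k
    using s(2)[of k] by (auto simp: s_eq next_to_def)
  have M_anti: "M (k + j) \<subseteq> M k" for k j
    by (induction j) (use nxt(4) in auto)
  have later: "n j \<in> M k" if kj: "k < j" for k j
  proof -
    obtain i where "j = Suc (k + i)" using less_imp_Suc_add[OF kj] by auto
    with nxt(2)[of "k + i"] M_anti[of k i] show ?thesis by auto
  qed
  have A_eq: "A k = A 0 \<union> n ` {..<k}" for k
    by (induction k) (auto simp: nxt(1) lessThan_Suc)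
  define B where "B = A 0 \<union> range n"
  have "e / 2 \<le> \<bar>\<mu> (n k) B\<bar>" for k
  proof -
    define R where "R = n ` {k<..}"
    have RM: "R \<subseteq> M k" using later by (auto simp: R_def)
    have "{..<k} \<union> {k} \<union> {k<..} = UNIV" by auto
    then have "range n = n ` ({..<k} \<union> {k} \<union> {k<..})" by (rule arg_cong[symmetric])
    then have "range n = n ` {..<k} \<union> {n k} \<union> R" by (simp add: R_def image_Un)
    then have B: "B = A k \<union> ({n k} \<union> R)" by (auto simp: B_def A_eq[of k])
    have "{n k} \<inter> R = {}" "A k \<inter> ({n k} \<union> R) = {}" using good(2,3)[of k] RM by auto
    then have "\<mu> (n k) B = \<mu> (n k) (A k) + (\<mu> (n k) {n k} + \<mu> (n k) R)"
      by (simp only: B \<mu>_add)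
    moreover have "\<bar>\<mu> (n k) R\<bar> < e / 4"
      using bound[of "n k" R] \<nu>_mono[OF RM, of "n k"] good(5)[of k] by linarith
    moreover have "e \<le> \<bar>\<mu> (n k) {n k}\<bar>" using good(1)[of k] by (simp add: S_def)
    ultimately show ?thesis using good(4)[of k] by linarith
  qed
  moreover have "strict_mono n" using nxt(3) by (simp add: strict_mono_Suc_iff)
  then have "(\<lambda>k. \<mu> (n k) B) \<longlonglongrightarrow> 0"
    using LIMSEQ_subseq_LIMSEQ[OF lim[of B]] by (simp add: o_def)
  then have "\<forall>\<^sub>F k in sequentially. dist (\<mu> (n k) B) 0 < e / 2"
    using e by (intro tendstoD) auto
  then obtain k where "\<bar>\<mu> (n k) B\<bar> < e / 2" by (auto simp: eventually_sequentially)
  ultimately show False by (metis not_less)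
qed

text \<open>
  \<^term>\<open>m A\<close> is the supremum of the \<^term>\<open>z n\<close> with \<^term>\<open>n \<in> A\<close>. It is additive because the sum of two
  disjoint positive elements is their supremum, so that \<^term>\<open>z i + z j \<le> m (A \<union> B)\<close> for
  \<^term>\<open>i \<in> A\<close> and \<^term>\<open>j \<in> B\<close>.
\<close>

lemma disjoint_order_bounded_measure:
  fixes z :: "nat \<Rightarrow> 'a::banach_lattice"
  assumes \<sigma>: "sigma_dedekind_complete TYPE('a)"
    and disj: "\<And>i j. i \<noteq> j \<Longrightarrow> inf (z i) (z j) = 0"
    and z: "\<And>n. 0 \<le> z n" "\<And>n. z n \<le> x"
  obtains m :: "nat set \<Rightarrow> 'a" where "\<And>A. 0 \<le> m A" "\<And>n. m {n} = z n"
    "\<And>A B. A \<inter> B = {} \<Longrightarrow> m (A \<union> B) = m A + m B"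
proof -
  have x: "0 \<le> x" using z[of 0] by (rule order_trans)
  \<comment> \<open>The element \<^term>\<open>0\<close> is adjoined so that the empty set has a supremum, namely \<^term>\<open>0\<close>.\<close>
  define lub where "lub A s \<longleftrightarrow>
    (\<forall>a\<in>insert 0 (z ` A). a \<le> s) \<and> (\<forall>b. (\<forall>a\<in>insert 0 (z ` A). a \<le> b) \<longrightarrow> s \<le> b)" for A s
  have "\<exists>s. lub A s" for A
  proof -
    have "bdd_above (insert 0 (z ` A))" using z x by (intro bdd_aboveI[of _ x]) auto
    moreover have "countable (insert 0 (z ` A))" by simp
    ultimately show ?thesis
      using \<sigma>[unfolded sigma_dedekind_complete_def, rule_format, of "insert 0 (z ` A)"]
      by (simp add: lub_def)
  qed
  then obtain m where m: "\<And>A. lub A (m A)" by metis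
  have m0: "0 \<le> m A" and mz: "n \<in> A \<Longrightarrow> z n \<le> m A" for A n using m[of A] by (auto simp: lub_def)
  have least: "m A \<le> b" if "0 \<le> b" "\<And>n. n \<in> A \<Longrightarrow> z n \<le> b" for A b
    using m[of A] that by (auto simp: lub_def)
  show thesis
  proof (rule that[of m, OF m0])
    show "m {n} = z n" for n
      using z by (intro antisym least mz) auto
    fix A B :: "nat set" assume AB: "A \<inter> B = {}"
    show "m (A \<union> B) = m A + m B"
    proof (rule antisym)
      show "m (A \<union> B) \<le> m A + m B"
        by (intro least) (auto intro: add_increasing add_increasing2 m0 mz)
      have mono: "m A \<le> m (A \<union> B)" "m B \<le> m (A \<union> B)"
        by (intro least m0 mz; simp)+
      have sum: "z i + z j \<le> m (A \<union> B)" if "i \<in> A" "j \<in> B" for i j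
      proof -
        have "z i + z j = sup (z i) (z j)"
          using disj[of i j] AB that by (subst add_eq_inf_sup) auto
        with that show ?thesis by (simp add: mz)
      qed
      have "m A \<le> m (A \<union> B) - z j" if "j \<in> B" for j
        using sum[OF _ that] mz[of j "A \<union> B"] that by (intro least) (auto simp: algebra_simps)
      then have "m B \<le> m (A \<union> B) - m A"
        using mono by (intro least) (auto simp: algebra_simps)
      then show "m A + m B \<le> m (A \<union> B)" by (simp add: algebra_simps)
    qed
  qed
qed

section \<open>Components of weak* null sequences\<close>

text \<open>
  Phillips' lemma for the scalar measures \<^term>\<open>\<lambda>A. f n (m A)\<close>, dominated by \<open>\<bar>f n\<bar> (m A)\<close>,
  where \<^term>\<open>m\<close> is the measure of the preceding lemma.
\<close>

lemma weak_star_null_disjoint_order_bounded: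
  fixes f :: "nat \<Rightarrow> 'a::banach_lattice \<Rightarrow>\<^sub>L real"
  assumes \<sigma>: "sigma_dedekind_complete TYPE('a)" and f: "weak_star_null f"
    and disj: "\<And>i j. i \<noteq> j \<Longrightarrow> inf (z i) (z j) = 0"
    and z: "\<And>n. 0 \<le> z n" "\<And>n. z n \<le> x"
  shows "(\<lambda>n. blinfun_apply (f n) (z n)) \<longlonglongrightarrow> 0"
proof -
  obtain m :: "nat set \<Rightarrow> 'a" where m: "\<And>A. 0 \<le> m A" "\<And>n. m {n} = z n"
      and add: "\<And>A B. A \<inter> B = {} \<Longrightarrow> m (A \<union> B) = m A + m B"
    by (rule disjoint_order_bounded_measure[OF \<sigma> disj z]) auto
  have "(\<lambda>n. blinfun_apply (f n) (m {n})) \<longlonglongrightarrow> 0"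
  proof (rule phillips_lemma[where \<nu> = "\<lambda>n A. blinfun_apply \<bar>f n\<bar> (m A)"])
    show "(\<lambda>n. blinfun_apply (f n) (m A)) \<longlonglongrightarrow> 0" for A
      using f by (simp add: weak_star_null_def)
    show "\<bar>blinfun_apply (f n) (m A)\<bar> \<le> blinfun_apply \<bar>f n\<bar> (m A)" for n A
      by (rule abs_blinfun_apply_le[OF m(1)])
  qed (simp_all add: add blinfun.add_right)
  then show ?thesis by (simp add: m(2))
qed

text \<open>
  For \<^term>\<open>x \<ge> 0\<close> the component at \<^term>\<open>x\<close> is nearly \<open>\<bar>f n\<bar> (w n)\<close> with
  \<open>w n = inf x (t n *\<^sub>R u n)\<close>, and that is nearly \<open>2 * f n (y n) - f n (w n)\<close> with \<open>0 \<le> y n \<le> w n\<close>.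
  Both \<open>w\<close> and \<open>y\<close> are disjoint and bounded by \<^term>\<open>x\<close>.
\<close>

lemma weak_star_null_component_abs:
  fixes f :: "nat \<Rightarrow> 'a::banach_lattice \<Rightarrow>\<^sub>L real"
  assumes \<sigma>: "sigma_dedekind_complete TYPE('a)" and f: "weak_star_null f"
    and u: "\<And>n. 0 \<le> u n" and disj: "\<And>i j. i \<noteq> j \<Longrightarrow> inf (u i) (u j) = 0"
  shows "weak_star_null (\<lambda>n. component \<bar>f n\<bar> (u n))"
proof -
  have pos: "(\<lambda>n. blinfun_apply (component \<bar>f n\<bar> (u n)) x) \<longlonglongrightarrow> 0" if x: "0 \<le> x" for x
  proof -
    define e where "e n = inverse (real (Suc n))" for n
    have e: "0 < e n" for n by (simp add: e_def)
    have e0: "e \<longlonglongrightarrow> 0" unfolding e_def by (rule LIMSEQ_inverse_real_of_nat)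
    have "\<exists>t. 0 \<le> t \<and> blinfun_apply (component \<bar>f n\<bar> (u n)) x
        < blinfun_apply \<bar>f n\<bar> (inf x (t *\<^sub>R u n)) + e n" for n
      using component_approx[OF abs_ge_zero u x e] by blast
    then obtain t where t: "\<And>n. 0 \<le> t n" "\<And>n. blinfun_apply (component \<bar>f n\<bar> (u n)) x
        < blinfun_apply \<bar>f n\<bar> (inf x (t n *\<^sub>R u n)) + e n" by metis
    define w where "w n = inf x (t n *\<^sub>R u n)" for n
    have tu: "0 \<le> t n *\<^sub>R u n" for n using t(1) u by (rule scaleR_nonneg_nonneg)
    have w: "0 \<le> w n" "w n \<le> x" "w n \<le> t n *\<^sub>R u n" for n using x tu by (auto simp: w_def)
    have w_disj: "inf (w i) (w j) = 0" if "i \<noteq> j" for i j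
      by (rule inf_eq_0_mono[OF inf_scaleR_eq_0[OF disj[OF that] t(1) t(1)] w(1,3) w(1,3)])
    have "\<exists>y. 0 \<le> y \<and> y \<le> w n \<and> blinfun_apply \<bar>f n\<bar> (w n)
        < 2 * blinfun_apply (f n) y - blinfun_apply (f n) (w n) + e n" for n
      using abs_blinfun_approx[OF w(1) e] by blast
    then obtain y where y: "\<And>n. 0 \<le> y n" "\<And>n. y n \<le> w n"
      "\<And>n. blinfun_apply \<bar>f n\<bar> (w n)
        < 2 * blinfun_apply (f n) (y n) - blinfun_apply (f n) (w n) + e n" by metis
    have y_disj: "inf (y i) (y j) = 0" if "i \<noteq> j" for i j
      by (rule inf_eq_0_mono[OF w_disj[OF that] y(1,2) y(1,2)])
    have fw: "(\<lambda>n. blinfun_apply (f n) (w n)) \<longlonglongrightarrow> 0"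
      by (rule weak_star_null_disjoint_order_bounded[OF \<sigma> f w_disj w(1,2)])
    have fy: "(\<lambda>n. blinfun_apply (f n) (y n)) \<longlonglongrightarrow> 0"
      by (rule weak_star_null_disjoint_order_bounded[OF \<sigma> f y_disj y(1) order_trans[OF y(2) w(2)]])
    show ?thesis
    proof (rule Lim_null_comparison[OF always_eventually[OF allI]])
      fix n
      have "0 \<le> blinfun_apply (component \<bar>f n\<bar> (u n)) x"
        using component_nonneg[OF abs_ge_zero u] x by (simp add: blinfun_nonneg_iff)
      then show "norm (blinfun_apply (component \<bar>f n\<bar> (u n)) x)
          \<le> 2 * blinfun_apply (f n) (y n) - blinfun_apply (f n) (w n) + 2 * e n"
        using t(2)[of n] y(3)[of n] unfolding w_def by simp
    next
      show "(\<lambda>n. 2 * blinfun_apply (f n) (y n) - blinfun_apply (f n) (w n) + 2 * e n) \<longlonglongrightarrow> 0"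
        using tendsto_add[OF tendsto_diff[OF tendsto_mult_left[OF fy, of 2] fw]
          tendsto_mult_left[OF e0, of 2]] by simp
    qed
  qed
  show ?thesis
    unfolding weak_star_null_def
  proof
    fix x
    have "(\<lambda>n. blinfun_apply (component \<bar>f n\<bar> (u n)) (pprt x)
        - blinfun_apply (component \<bar>f n\<bar> (u n)) (pprt (- x))) \<longlonglongrightarrow> 0 - 0"
      by (intro tendsto_diff pos) simp_all
    moreover have "pprt x - pprt (- x) = x" using prts[of x] by (simp add: pprt_neg)
    ultimately show "(\<lambda>n. blinfun_apply (component \<bar>f n\<bar> (u n)) x) \<longlonglongrightarrow> 0"
      by (simp flip: blinfun.diff_right)
  qed
qed

section \<open>Diagonal sequences and the equivalences\<close>

lemma disjoint_seq_pprt: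
  fixes x :: "nat \<Rightarrow> 'a::banach_lattice"
  assumes "disjoint_seq x" and "i \<noteq> j"
  shows "inf (pprt (x i)) (pprt (x j)) = 0"
proof (rule inf_eq_0_mono)
  show "inf \<bar>x i\<bar> \<bar>x j\<bar> = 0" using assms by (simp add: disjoint_seq_def)
  show "pprt (x i) \<le> \<bar>x i\<bar>" "pprt (x j) \<le> \<bar>x j\<bar>" by (simp_all add: abs_prts)
qed simp_all

lemma weakly_p_summable_subseq:
  assumes "weakly_p_summable p x" and "inj r"
  shows "weakly_p_summable p (x \<circ> r)"
  unfolding weakly_p_summable_def
proof
  fix f :: "'a \<Rightarrow>\<^sub>L real"
  have "summable ((\<lambda>n. \<bar>blinfun_apply f (x n)\<bar> powr p) \<circ> r)"
    using assms by (intro summable_reindex) (auto simp: weakly_p_summable_def)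
  then show "summable (\<lambda>n. \<bar>blinfun_apply f ((x \<circ> r) n)\<bar> powr p)" by (simp add: o_def)
qed

lemma weakly_p_summable_uminus:
  "weakly_p_summable p x \<Longrightarrow> weakly_p_summable p (\<lambda>n. - x n)"
  by (simp add: weakly_p_summable_def blinfun.minus_right)

text \<open>
  Since the modulus of \<^term>\<open>f n\<close> dominates \<^term>\<open>f n\<close>, it is enough that \<^term>\<open>\<bar>f n\<bar>\<close> tends to
  \<^term>\<open>0::real\<close> along the positive parts of \<^term>\<open>x n\<close> and of \<^term>\<open>- x n\<close>. Each of the two is the
  hypothesis for \<^term>\<open>x\<close> or \<^term>\<open>\<lambda>n. - x n\<close> itself, applied to components of \<^term>\<open>\<bar>f n\<bar>\<close>.
\<close>

lemma diagonal_null_if_positive_disjoint_null: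
  fixes x :: "nat \<Rightarrow> 'a::banach_lattice" and f :: "nat \<Rightarrow> 'a \<Rightarrow>\<^sub>L real"
  assumes \<sigma>: "sigma_dedekind_complete TYPE('a)"
    and pos: "\<And>(x :: nat \<Rightarrow> 'a) f. disjoint_seq x \<Longrightarrow> weakly_p_summable p x \<Longrightarrow>
      positive_seq f \<Longrightarrow> disjoint_seq f \<Longrightarrow> weak_star_null f \<Longrightarrow>
      (\<lambda>n. blinfun_apply (f n) (x n)) \<longlonglongrightarrow> 0"
    and x: "disjoint_seq x" "weakly_p_summable p x" and f: "weak_star_null f"
  shows "(\<lambda>n. blinfun_apply (f n) (x n)) \<longlonglongrightarrow> 0"
proof -
  have part: "(\<lambda>n. blinfun_apply \<bar>f n\<bar> (pprt (x n))) \<longlonglongrightarrow> 0"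
    if x: "disjoint_seq x" "weakly_p_summable p x" for x
  proof -
    define g where "g n = component \<bar>f n\<bar> (pprt (x n))" for n
    have g0: "0 \<le> g n" for n by (simp add: g_def component_nonneg)
    have "(\<lambda>n. blinfun_apply (g n) (x n)) \<longlonglongrightarrow> 0"
    proof (rule pos[OF x])
      show "positive_seq g" by (simp add: positive_seq_def g0)
      show "disjoint_seq g"
        using g0 disjoint_seq_pprt[OF x(1)]
        by (auto simp: disjoint_seq_def g_def intro!: inf_component_eq_0)
      show "weak_star_null g"
        unfolding g_def by (intro weak_star_null_component_abs \<sigma> f disjoint_seq_pprt x) simp_all
    qed
    moreover have "blinfun_apply (g n) (x n) = blinfun_apply \<bar>f n\<bar> (pprt (x n))" for n
    proof -
      have "x n = pprt (x n) - pprt (- x n)" using prts[of "x n"] by (simp add: pprt_neg)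
      then have "blinfun_apply (g n) (x n)
          = blinfun_apply (g n) (pprt (x n)) - blinfun_apply (g n) (pprt (- x n))"
        by (metis blinfun.diff_right)
      also have "\<dots> = blinfun_apply \<bar>f n\<bar> (pprt (x n)) - 0"
        unfolding g_def
        by (intro arg_cong2[of _ _ _ _ minus] component_eq_0 component_eq_on_band[of _ _ _ 1]
            inf_pprt_uminus) simp_all
      finally show ?thesis by simp
    qed
    ultimately show ?thesis by simp
  qed
  have "disjoint_seq (\<lambda>n. - x n)" using x(1) by (simp add: disjoint_seq_def)
  from part[OF this weakly_p_summable_uminus[OF x(2)]] part[OF x]
  have "(\<lambda>n. blinfun_apply \<bar>f n\<bar> (pprt (x n)) + blinfun_apply \<bar>f n\<bar> (pprt (- x n))) \<longlonglongrightarrow> 0 + 0"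
    by (intro tendsto_add)
  then have lim: "(\<lambda>n. blinfun_apply \<bar>f n\<bar> (pprt (x n)) + blinfun_apply \<bar>f n\<bar> (pprt (- x n))) \<longlonglongrightarrow> 0"
    by simp
  show ?thesis
  proof (rule Lim_null_comparison[OF always_eventually[OF allI] lim])
    fix n
    have "x n = pprt (x n) - pprt (- x n)" using prts[of "x n"] by (simp add: pprt_neg)
    then have "blinfun_apply (f n) (x n) = blinfun_apply (f n) (pprt (x n)) - blinfun_apply (f n) (pprt (- x n))"
      by (metis blinfun.diff_right)
    then show "norm (blinfun_apply (f n) (x n))
        \<le> blinfun_apply \<bar>f n\<bar> (pprt (x n)) + blinfun_apply \<bar>f n\<bar> (pprt (- x n))"
      using abs_blinfun_apply_le[of "pprt (x n)" "f n"] abs_blinfun_apply_le[of "pprt (- x n)" "f n"]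
      by simp
  qed
qed

text \<open>
  A failure of uniform convergence at infinitely many \<^term>\<open>k\<close> is witnessed by points \<^term>\<open>x n\<close>. Each
  single point is a witness for only finitely many \<^term>\<open>k\<close>, so the witnesses can be chosen with
  increasing indices.
\<close>

lemma limited_range_if_diagonals_null:
  fixes x :: "nat \<Rightarrow> 'a::banach"
  assumes diag: "\<And>r (f :: nat \<Rightarrow> 'a \<Rightarrow>\<^sub>L real). strict_mono r \<Longrightarrow> weak_star_null f
    \<Longrightarrow> (\<lambda>n. blinfun_apply (f n) (x (r n))) \<longlonglongrightarrow> 0"
  shows "limited (range x)"
  unfolding limited_def
proof (intro allI impI)
  fix f :: "nat \<Rightarrow> 'a \<Rightarrow>\<^sub>L real"
  assume f: "weak_star_null f"
  show "uniform_limit (range x) (\<lambda>n. blinfun_apply (f n)) (\<lambda>_. 0) sequentially"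
  proof (rule ccontr)
    assume "\<not> ?thesis"
    then obtain e where e: "0 < e"
      and "\<not> (\<forall>\<^sub>F n in sequentially. \<forall>y\<in>range x. dist (blinfun_apply (f n) y) 0 < e)"
      unfolding uniform_limit_iff by auto
    then have freq: "\<exists>k\<ge>K. \<exists>n. e \<le> \<bar>blinfun_apply (f k) (x n)\<bar>" for K
      by (auto simp: eventually_sequentially not_less)
    have step: "\<exists>k n. K < k \<and> N < n \<and> e \<le> \<bar>blinfun_apply (f k) (x n)\<bar>" for K N
    proof -
      have "\<forall>\<^sub>F k in sequentially. dist (blinfun_apply (f k) (x n)) 0 < e" for n
        using f e by (intro tendstoD) (auto simp: weak_star_null_def)
      then have "\<forall>\<^sub>F k in sequentially. \<forall>n\<in>{..N}. dist (blinfun_apply (f k) (x n)) 0 < e"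
        by (simp add: eventually_ball_finite_distrib)
      then obtain K' where K': "\<And>k n. K' \<le> k \<Longrightarrow> n \<le> N \<Longrightarrow> \<bar>blinfun_apply (f k) (x n)\<bar> < e"
        by (auto simp: eventually_sequentially)
      obtain k n where kn: "max K' (Suc K) \<le> k" "e \<le> \<bar>blinfun_apply (f k) (x n)\<bar>"
        using freq by blast
      then have "N < n" using K'[of k n] by (cases "n \<le> N") auto
      moreover have "K < k" using kn(1) by simp
      ultimately show ?thesis using kn(2) by blast
    qed
    define far where "far s \<longleftrightarrow> e \<le> \<bar>blinfun_apply (f (fst s)) (x (snd s))\<bar>" for s
    have "\<exists>s. \<forall>j. far (s j) \<and> (fst (s j) < fst (s (Suc j)) \<and> snd (s j) < snd (s (Suc j)))"
    proof (rule dependent_nat_choice)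
      show "\<exists>s. far s" using step[of 0 0] by (auto simp: far_def)
      show "\<exists>s'. far s' \<and> fst s < fst s' \<and> snd s < snd s'" for s
        using step[of "fst s" "snd s"] by (auto simp: far_def)
    qed
    then obtain s where far: "\<And>j. far (s j)"
      and mono: "\<And>j. fst (s j) < fst (s (Suc j))" "\<And>j. snd (s j) < snd (s (Suc j))" by blast
    define k r where "k j = fst (s j)" and "r j = snd (s j)" for j
    have k: "strict_mono k" and r: "strict_mono r"
      using mono by (simp_all add: k_def r_def strict_mono_Suc_iff)
    have "weak_star_null (f \<circ> k)"
      unfolding weak_star_null_def
    proof
      fix y
      show "(\<lambda>j. blinfun_apply ((f \<circ> k) j) y) \<longlonglongrightarrow> 0"
        using LIMSEQ_subseq_LIMSEQ[OF _ k, of "\<lambda>j. blinfun_apply (f j) y" 0] f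
        by (simp add: weak_star_null_def o_def)
    qed
    from diag[OF r this] have "\<forall>\<^sub>F j in sequentially. dist (blinfun_apply ((f \<circ> k) j) (x (r j))) 0 < e"
      using e by (intro tendstoD)
    then obtain j where "\<bar>blinfun_apply (f (k j)) (x (r j))\<bar> < e"
      by (auto simp: eventually_sequentially)
    with far[of j] show False by (simp add: far_def k_def r_def)
  qed
qed

lemma uniform_limit_range_diagonal:
  fixes f :: "nat \<Rightarrow> 'a \<Rightarrow> real"
  assumes "uniform_limit (range x) f (\<lambda>_. 0) sequentially"
  shows "(\<lambda>n. f n (x n)) \<longlonglongrightarrow> 0"
  using assms unfolding uniform_limit_iff tendsto_iff by (auto elim!: eventually_mono)

theorem theorem3p4:
  fixes p :: real
  assumes "p \<ge> 1"
    and "sigma_dedekind_complete TYPE('a::banach_lattice)"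
  shows
    "(disjoint_DP_star p TYPE('a)
      \<longleftrightarrow>
      (\<forall>x::nat \<Rightarrow> 'a. disjoint_seq x \<and> weakly_p_summable p x \<longrightarrow> almost_limited (range x)))
    \<and>
     (disjoint_DP_star p TYPE('a)
      \<longleftrightarrow>
      (\<forall>(x::nat \<Rightarrow> 'a) (f::nat \<Rightarrow> 'a \<Rightarrow>\<^sub>L real).
        disjoint_seq x \<and> weakly_p_summable p x \<and> disjoint_seq f \<and> weak_star_null f
          \<longrightarrow> (\<lambda>n. blinfun_apply (f n) (x n)) \<longlonglongrightarrow> 0))
    \<and>
     (disjoint_DP_star p TYPE('a)
      \<longleftrightarrow>
      (\<forall>(x::nat \<Rightarrow> 'a) (f::nat \<Rightarrow> 'a \<Rightarrow>\<^sub>L real).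
        disjoint_seq x \<and> weakly_p_summable p x \<and>
        positive_seq f \<and> disjoint_seq f \<and> weak_star_null f
          \<longrightarrow> (\<lambda>n. blinfun_apply (f n) (x n)) \<longlonglongrightarrow> 0))
    \<and>
     (disjoint_DP_star p TYPE('a)
      \<longleftrightarrow>
      (\<forall>(x::nat \<Rightarrow> 'a) (f::nat \<Rightarrow> 'a \<Rightarrow>\<^sub>L real).
        disjoint_seq x \<and> weakly_p_summable p x \<and> positive_seq f \<and> weak_star_null f
          \<longrightarrow> (\<lambda>n. blinfun_apply (f n) (x n)) \<longlonglongrightarrow> 0))"
    (is "(?a \<longleftrightarrow> ?b) \<and> (?a \<longleftrightarrow> ?c) \<and> (?a \<longleftrightarrow> ?d) \<and> (?a \<longleftrightarrow> ?e)")
proof -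
  have ab: ?b if a: ?a
  proof (intro allI impI)
    fix x :: "nat \<Rightarrow> 'a"
    assume "disjoint_seq x \<and> weakly_p_summable p x"
    with a have "limited (range x)" by (simp add: disjoint_DP_star_def)
    then show "almost_limited (range x)"
      by (simp add: almost_limited_def limited_imp_bounded) (simp add: limited_def)
  qed
  have bc: ?c if b: ?b
  proof (intro allI impI, elim conjE)
    fix x :: "nat \<Rightarrow> 'a" and f :: "nat \<Rightarrow> 'a \<Rightarrow>\<^sub>L real"
    assume "disjoint_seq x" "weakly_p_summable p x" and f: "disjoint_seq f" "weak_star_null f"
    with b have "almost_limited (range x)" by simp
    with f show "(\<lambda>n. blinfun_apply (f n) (x n)) \<longlonglongrightarrow> 0"
      by (intro uniform_limit_range_diagonal) (simp add: almost_limited_def)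
  qed
  have cd: ?d if ?c using that by simp
  have ae: ?e if a: ?a
  proof (intro allI impI, elim conjE)
    fix x :: "nat \<Rightarrow> 'a" and f :: "nat \<Rightarrow> 'a \<Rightarrow>\<^sub>L real"
    assume "disjoint_seq x" "weakly_p_summable p x" and f: "weak_star_null f"
    with a have "limited (range x)" by (simp add: disjoint_DP_star_def)
    with f show "(\<lambda>n. blinfun_apply (f n) (x n)) \<longlonglongrightarrow> 0"
      by (intro uniform_limit_range_diagonal) (simp add: limited_def)
  qed
  have ed: ?d if ?e using that by simp
  have da: ?a if d: ?d
    unfolding disjoint_DP_star_def
  proof (intro allI impI, elim conjE)
    fix x :: "nat \<Rightarrow> 'a"
    assume x: "disjoint_seq x" "weakly_p_summable p x"
    show "limited (range x)"
    proof (rule limited_range_if_diagonals_null)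
      fix r :: "nat \<Rightarrow> nat" and f :: "nat \<Rightarrow> 'a \<Rightarrow>\<^sub>L real"
      assume r: "strict_mono r" and f: "weak_star_null f"
      have inj: "inj r" using r by (rule strict_mono_imp_inj_on)
      have "(\<lambda>n. blinfun_apply (f n) ((x \<circ> r) n)) \<longlonglongrightarrow> 0"
      proof (rule diagonal_null_if_positive_disjoint_null[OF assms(2) _ _ _ f])
        show "disjoint_seq (x \<circ> r)" using x(1) inj by (auto simp: disjoint_seq_def inj_eq)
        show "weakly_p_summable p (x \<circ> r)" using x(2) inj by (rule weakly_p_summable_subseq)
      qed (use d in simp)
      then show "(\<lambda>n. blinfun_apply (f n) (x (r n))) \<longlonglongrightarrow> 0" by simp
    qed
  qed
  show ?thesis
  proof (intro conjI)
    show "?a \<longleftrightarrow> ?b" by (rule iffI[OF ab da[OF cd[OF bc]]])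
    show "?a \<longleftrightarrow> ?c" by (rule iffI[OF bc[OF ab] da[OF cd]])
    show "?a \<longleftrightarrow> ?d" by (rule iffI[OF cd[OF bc[OF ab]] da])
    show "?a \<longleftrightarrow> ?e" by (rule iffI[OF ae da[OF ed]])
  qed
qed

end
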